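(* Let $(E,\rho,[\cdot,\cdot]_E,g)$ be an almost-Courant algebroid over $M$, regarded as a local almost-Leibniz algebroid with locality operator $L(\Omega,u,v)=g(u,v)\,g^{-1}(\Omega)$. A linear $E$-connection $\nabla$ is admissible if and only if it is $E$-metric-$g$-compatible, i.e. $\rho(w)(g(u,v))=g(\nabla_wu,v)+g(u,\nabla_wv)$ for all $u,v,w\in\mathfrak{X}(E)$.
   Context: Everything is smooth. $M$ is a manifold, $E\to M$ a real vector bundle of constant rank, $\mathfrak{X}(E)=\Gamma(E)$, $\Omega^1(E)=\Gamma(E^* )$. An anchored vector bundle $(E,\rho)$ has a vector bundle morphism $\rho:E\to T(M)$ over the identity. An almost-Leibniz algebroid $(E,\rho,[\cdot,\cdot]_E)$ is an anchored vector bundle with an $\mathbb{R}$-bilinear bracket on $\mathfrak{X}(E)$ satisfying $[u,fv]_E=\rho(u)(f)v+f[u,v]_E$. It is local with locality operator $L$, a $C^\infty(M,\mathbb{R})$-multilinear map $L:\Omega^1(E)\times\mathfrak{X}(E)\times\mathfrak{X}(E)\to\mathfrak{X}(E)$, if $[fu,v]_E=-\rho(v)(f)u+f[u,v]_E+L(Df,u,v)$, where $(Df)(u):=\rho(u)(f)$. An $E$-metric is a non-degenerate symmetric fiberwise bilinear form on $E$; $g^{-1}:E^*\to E$ is the inverse of $u\mapsto g(u,\cdot)$. An almost-Courant algebroid $(E,\rho,[\cdot,\cdot]_E,g)$ is an almost-Leibniz algebroid with an $E$-metric $g$ such that $[u,v]_E+[v,u]_E=g^{-1}(D(g(u,v)))$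 for all $u,v$. A linear $E$-connection is an $\mathbb{R}$-bilinear map $\nabla:\mathfrak{X}(E)\times\mathfrak{X}(E)\to\mathfrak{X}(E)$ with $\nabla_u(fv)=\rho(u)(f)v+f\nabla_uv$ and $\nabla_{fu}v=f\nabla_uv$. $(X_a)$ denotes a local frame of $E$, $(e^a)$ the dual coframe, repeated indices are summed. $\nabla$ is admissible (with respect to $L$) if $[u,v]_E+[v,u]_E=L(e^a,\nabla_{X_a}u,v)+L(e^a,\nabla_{X_a}v,u)$ for all $u,v\in\mathfrak{X}(E)$. *)

theory Defs
  imports "HOL-Analysis.Analysis"
begin

section \<open>Smooth functions of n real variables\<close>

text \<open>Points of n-space are the elements of \<^const>\<open>Euclidean_space\<close> \<open>n\<close>, i.e. sequences vanishing from
  index \<open>n\<close> on; the cases of dimension 0 and rank 0 are thus included. Below, \<open>V\<close> is always an open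
  subset of n-space.\<close>

primrec iterated_partial ::
    "nat list \<Rightarrow> ((nat \<Rightarrow> real) \<Rightarrow> real) \<Rightarrow> (nat \<Rightarrow> real) \<Rightarrow> real" where
  "iterated_partial [] f = f"
| "iterated_partial (i # js) f = (\<lambda>x. deriv (\<lambda>t. iterated_partial js f (x(i := t))) (x i))"

definition smooth_Rn :: "nat \<Rightarrow> (nat \<Rightarrow> real) set \<Rightarrow> ((nat \<Rightarrow> real) \<Rightarrow> real) \<Rightarrow> bool" where
  "smooth_Rn n V f \<longleftrightarrow>
     (\<forall>js. set js \<subseteq> {..<n} \<longrightarrow>
        continuous_on V (iterated_partial js f) \<and>
        (\<forall>x\<in>V. \<forall>i<n. (\<lambda>t. iterated_partial js f (x(i := t))) differentiable (at (x i))))"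


section \<open>Smooth manifolds\<close>

text \<open>The points of the manifold are all points of the (Hausdorff, second countable) type \<open>'m\<close>.
  The atlas need not be maximal.\<close>

record 'm smooth_structure =
  dimension :: nat
  atlas :: "('m set \<times> ('m \<Rightarrow> nat \<Rightarrow> real)) set"

definition smooth_manifold ::
    "('m :: {t2_space, second_countable_topology}) smooth_structure \<Rightarrow> bool" where
  "smooth_manifold M \<longleftrightarrow>
     (\<Union>(U, \<phi>)\<in>atlas M. U) = UNIV \<and>
     (\<forall>(U, \<phi>)\<in>atlas M. open U \<and> openin (Euclidean_space (dimension M)) (\<phi> ` U) \<and>
        homeomorphic_map (top_of_set U) (subtopology (Euclidean_space (dimension M)) (\<phi> ` U)) \<phi>) \<and>
     (\<forall>(U, \<phi>)\<in>atlas M. \<forall>(V, \<psi>)\<in>atlas M. \<forall>i<dimension M.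
        smooth_Rn (dimension M) (\<phi> ` (U \<inter> V)) (\<lambda>x. \<psi> (inv_into U \<phi> x) i))"

definition smooth_on ::
    "('m :: {t2_space, second_countable_topology}) smooth_structure \<Rightarrow> 'm set \<Rightarrow> ('m \<Rightarrow> real) \<Rightarrow> bool"
  where
  "smooth_on M W f \<longleftrightarrow>
     (\<forall>(U, \<phi>)\<in>atlas M. smooth_Rn (dimension M) (\<phi> ` (U \<inter> W)) (\<lambda>x. f (inv_into U \<phi> x)))"

definition smooth_functions ::
    "('m :: {t2_space, second_countable_topology}) smooth_structure \<Rightarrow> ('m \<Rightarrow> real) set" where
  "smooth_functions M = {f. smooth_on M UNIV f}"

text \<open>Tangent vectors at \<open>p\<close> are the derivations at \<open>p\<close> of the algebra of smooth functions. Their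
  value is fixed to be 0 on functions that are not smooth, so that a derivation has only one
  representation as a HOL function.\<close>

definition tangent_space ::
    "('m :: {t2_space, second_countable_topology}) smooth_structure \<Rightarrow> 'm \<Rightarrow>
     (('m \<Rightarrow> real) \<Rightarrow> real) set" where
  "tangent_space M p = {D.
     (\<forall>f\<in>smooth_functions M. \<forall>h\<in>smooth_functions M. D (\<lambda>q. f q + h q) = D f + D h) \<and>
     (\<forall>c. \<forall>f\<in>smooth_functions M. D (\<lambda>q. c * f q) = c * D f) \<and>
     (\<forall>f\<in>smooth_functions M. \<forall>h\<in>smooth_functions M.
        D (\<lambda>q. f q * h q) = f p * D h + h p * D f) \<and>
     (\<forall>f. f \<notin> smooth_functions M \<longrightarrow> D f = 0)}"


section \<open>Vector bundles\<close>

definition linear_form_on :: "'e :: real_vector set \<Rightarrow> ('e \<Rightarrow> real) \<Rightarrow> bool" where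
  "linear_form_on S \<alpha> \<longleftrightarrow>
     (\<forall>x\<in>S. \<forall>y\<in>S. \<alpha> (x + y) = \<alpha> x + \<alpha> y) \<and> (\<forall>c. \<forall>x\<in>S. \<alpha> (c *\<^sub>R x) = c * \<alpha> x)"

text \<open>A bundle is a family of fibres together with local trivializations \<open>(U, \<tau>)\<close>, where \<open>\<tau> p\<close> maps the
  fibre over \<open>p \<in> U\<close> isomorphically onto r-space and the transition matrices are smooth. The fibres
  are linear subspaces of the real vector space \<open>'e\<close> only in order to have vector space operations on
  them: they may vary arbitrarily with \<open>p\<close>, and topology and smooth structure of the total space come
  from the trivializations alone, so every vector bundle can be encoded in this way.\<close>

record ('m, 'e) vbundle =
  fibre :: "'m \<Rightarrow> 'e set"
  bundle_rank :: nat
  trivializations :: "('m set \<times> ('m \<Rightarrow> 'e \<Rightarrow> nat \<Rightarrow> real)) set"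

definition vector_bundle ::
    "('m :: {t2_space, second_countable_topology}) smooth_structure \<Rightarrow>
     ('m, 'e :: real_vector) vbundle \<Rightarrow> bool" where
  "vector_bundle M E \<longleftrightarrow>
     (\<forall>p. subspace (fibre E p)) \<and>
     (\<Union>(U, \<tau>)\<in>trivializations E. U) = UNIV \<and>
     (\<forall>(U, \<tau>)\<in>trivializations E. open U \<and>
        (\<forall>p\<in>U. (\<forall>a. linear_form_on (fibre E p) (\<lambda>x. \<tau> p x a)) \<and>
               bij_betw (\<tau> p) (fibre E p) (topspace (Euclidean_space (bundle_rank E))))) \<and>
     (\<forall>(U, \<tau>)\<in>trivializations E. \<forall>(V, \<sigma>)\<in>trivializations E.
        \<forall>a<bundle_rank E. \<forall>b<bundle_rank E.
          smooth_on M (U \<inter> V)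
            (\<lambda>p. \<sigma> p (inv_into (fibre E p) (\<tau> p) (\<lambda>i. if i = b then 1 else 0)) a))"

definition smooth_section_on ::
    "('m :: {t2_space, second_countable_topology}) smooth_structure \<Rightarrow>
     ('m, 'e :: real_vector) vbundle \<Rightarrow> 'm set \<Rightarrow> ('m \<Rightarrow> 'e) \<Rightarrow> bool" where
  "smooth_section_on M E W s \<longleftrightarrow>
     (\<forall>p\<in>W. s p \<in> fibre E p) \<and>
     (\<forall>(U, \<tau>)\<in>trivializations E. \<forall>a<bundle_rank E. smooth_on M (U \<inter> W) (\<lambda>p. \<tau> p (s p) a))"

definition sections ::
    "('m :: {t2_space, second_countable_topology}) smooth_structure \<Rightarrow>
     ('m, 'e :: real_vector) vbundle \<Rightarrow> ('m \<Rightarrow> 'e) set" where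
  "sections M E = {s. smooth_section_on M E UNIV s}"

text \<open>Covectors are linear forms on a fibre, extended by 0 to the whole type \<open>'e\<close>.\<close>

definition dual_fibre :: "('m, 'e :: real_vector) vbundle \<Rightarrow> 'm \<Rightarrow> ('e \<Rightarrow> real) set" where
  "dual_fibre E p =
     {\<alpha>. linear_form_on (fibre E p) \<alpha> \<and> (\<forall>x. x \<notin> fibre E p \<longrightarrow> \<alpha> x = 0)}"

definition one_forms ::
    "('m :: {t2_space, second_countable_topology}) smooth_structure \<Rightarrow>
     ('m, 'e :: real_vector) vbundle \<Rightarrow> ('m \<Rightarrow> 'e \<Rightarrow> real) set" where
  "one_forms M E = {\<Omega>. (\<forall>p. \<Omega> p \<in> dual_fibre E p) \<and>
     (\<forall>W s. open W \<and> smooth_section_on M E W s \<longrightarrow> smooth_on M W (\<lambda>p. \<Omega> p (s p)))}"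

definition local_frame ::
    "('m :: {t2_space, second_countable_topology}) smooth_structure \<Rightarrow>
     ('m, 'e :: real_vector) vbundle \<Rightarrow> 'm set \<Rightarrow> (nat \<Rightarrow> 'm \<Rightarrow> 'e) \<Rightarrow> bool" where
  "local_frame M E U X \<longleftrightarrow>
     open U \<and> (\<forall>a<bundle_rank E. smooth_section_on M E U (X a)) \<and>
     (\<forall>p\<in>U. inj_on (\<lambda>a. X a p) {..<bundle_rank E} \<and>
            independent ((\<lambda>a. X a p) ` {..<bundle_rank E}) \<and>
            span ((\<lambda>a. X a p) ` {..<bundle_rank E}) = fibre E p)"

definition dual_coframe ::
    "('m, 'e :: real_vector) vbundle \<Rightarrow> (nat \<Rightarrow> 'm \<Rightarrow> 'e) \<Rightarrow> nat \<Rightarrow> 'm \<Rightarrow> 'e \<Rightarrow> real" where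
  "dual_coframe E X a p x = representation ((\<lambda>b. X b p) ` {..<bundle_rank E}) x (X a p)"


section \<open>Algebroids\<close>

text \<open>The anchor is a morphism from \<open>E\<close> to the tangent bundle: \<open>\<rho> p\<close> is linear from the fibre over \<open>p\<close> to
  the tangent space at \<open>p\<close>, and \<open>\<rho>\<close> takes smooth (local) sections to smooth vector fields, a vector
  field being smooth iff it maps smooth functions to smooth functions.
  Thus \<open>\<rho> p (u p) f\<close> is the value of \<open>\<rho>(u)(f)\<close> at \<open>p\<close>.\<close>

definition anchored_vector_bundle ::
    "('m :: {t2_space, second_countable_topology}) smooth_structure \<Rightarrow>
     ('m, 'e :: real_vector) vbundle \<Rightarrow> ('m \<Rightarrow> 'e \<Rightarrow> ('m \<Rightarrow> real) \<Rightarrow> real) \<Rightarrow> bool" where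
  "anchored_vector_bundle M E \<rho> \<longleftrightarrow>
     smooth_manifold M \<and> vector_bundle M E \<and>
     (\<forall>p. \<forall>x\<in>fibre E p. \<rho> p x \<in> tangent_space M p) \<and>
     (\<forall>p f. linear_form_on (fibre E p) (\<lambda>x. \<rho> p x f)) \<and>
     (\<forall>W s. open W \<and> smooth_section_on M E W s \<longrightarrow>
        (\<forall>f\<in>smooth_functions M. smooth_on M W (\<lambda>p. \<rho> p (s p) f)))"

definition real_bilinear_on_sections ::
    "('m :: {t2_space, second_countable_topology}) smooth_structure \<Rightarrow>
     ('m, 'e :: real_vector) vbundle \<Rightarrow> (('m \<Rightarrow> 'e) \<Rightarrow> ('m \<Rightarrow> 'e) \<Rightarrow> 'm \<Rightarrow> 'e) \<Rightarrow> bool" where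
  "real_bilinear_on_sections M E B \<longleftrightarrow>
     (\<forall>u\<in>sections M E. \<forall>v\<in>sections M E. B u v \<in> sections M E) \<and>
     (\<forall>u\<in>sections M E. \<forall>v\<in>sections M E. \<forall>w\<in>sections M E.
        B (\<lambda>p. u p + v p) w = (\<lambda>p. B u w p + B v w p) \<and>
        B w (\<lambda>p. u p + v p) = (\<lambda>p. B w u p + B w v p)) \<and>
     (\<forall>c. \<forall>u\<in>sections M E. \<forall>v\<in>sections M E.
        B (\<lambda>p. c *\<^sub>R u p) v = (\<lambda>p. c *\<^sub>R B u v p) \<and>
        B u (\<lambda>p. c *\<^sub>R v p) = (\<lambda>p. c *\<^sub>R B u v p))"

definition almost_Leibniz_algebroid ::
    "('m :: {t2_space, second_countable_topology}) smooth_structure \<Rightarrow>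
     ('m, 'e :: real_vector) vbundle \<Rightarrow> ('m \<Rightarrow> 'e \<Rightarrow> ('m \<Rightarrow> real) \<Rightarrow> real) \<Rightarrow>
     (('m \<Rightarrow> 'e) \<Rightarrow> ('m \<Rightarrow> 'e) \<Rightarrow> 'm \<Rightarrow> 'e) \<Rightarrow> bool" where
  "almost_Leibniz_algebroid M E \<rho> br \<longleftrightarrow>
     anchored_vector_bundle M E \<rho> \<and> real_bilinear_on_sections M E br \<and>
     (\<forall>f\<in>smooth_functions M. \<forall>u\<in>sections M E. \<forall>v\<in>sections M E.
        br u (\<lambda>p. f p *\<^sub>R v p) = (\<lambda>p. \<rho> p (u p) f *\<^sub>R v p + f p *\<^sub>R br u v p))"

definition E_differential ::
    "('m, 'e :: real_vector) vbundle \<Rightarrow> ('m \<Rightarrow> 'e \<Rightarrow> ('m \<Rightarrow> real) \<Rightarrow> real) \<Rightarrow>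
     ('m \<Rightarrow> real) \<Rightarrow> 'm \<Rightarrow> 'e \<Rightarrow> real" where
  "E_differential E \<rho> f = (\<lambda>p x. if x \<in> fibre E p then \<rho> p x f else 0)"

definition E_metric ::
    "('m :: {t2_space, second_countable_topology}) smooth_structure \<Rightarrow>
     ('m, 'e :: real_vector) vbundle \<Rightarrow> ('m \<Rightarrow> 'e \<Rightarrow> 'e \<Rightarrow> real) \<Rightarrow> bool" where
  "E_metric M E g \<longleftrightarrow>
     (\<forall>p. \<forall>x\<in>fibre E p. linear_form_on (fibre E p) (g p x)) \<and>
     (\<forall>p. \<forall>x\<in>fibre E p. \<forall>y\<in>fibre E p. g p x y = g p y x) \<and>
     (\<forall>p. \<forall>x\<in>fibre E p. (\<forall>y\<in>fibre E p. g p x y = 0) \<longrightarrow> x = 0) \<and>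
     (\<forall>W s t. open W \<and> smooth_section_on M E W s \<and> smooth_section_on M E W t \<longrightarrow>
        smooth_on M W (\<lambda>p. g p (s p) (t p)))"

definition metric_inverse ::
    "('m, 'e :: real_vector) vbundle \<Rightarrow> ('m \<Rightarrow> 'e \<Rightarrow> 'e \<Rightarrow> real) \<Rightarrow> 'm \<Rightarrow> ('e \<Rightarrow> real) \<Rightarrow> 'e" where
  "metric_inverse E g p \<alpha> = (THE x. x \<in> fibre E p \<and> (\<forall>y\<in>fibre E p. g p x y = \<alpha> y))"

definition almost_Courant_algebroid ::
    "('m :: {t2_space, second_countable_topology}) smooth_structure \<Rightarrow>
     ('m, 'e :: real_vector) vbundle \<Rightarrow> ('m \<Rightarrow> 'e \<Rightarrow> ('m \<Rightarrow> real) \<Rightarrow> real) \<Rightarrow>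
     (('m \<Rightarrow> 'e) \<Rightarrow> ('m \<Rightarrow> 'e) \<Rightarrow> 'm \<Rightarrow> 'e) \<Rightarrow> ('m \<Rightarrow> 'e \<Rightarrow> 'e \<Rightarrow> real) \<Rightarrow> bool" where
  "almost_Courant_algebroid M E \<rho> br g \<longleftrightarrow>
     almost_Leibniz_algebroid M E \<rho> br \<and> E_metric M E g \<and>
     (\<forall>u\<in>sections M E. \<forall>v\<in>sections M E.
        (\<lambda>p. br u v p + br v u p) =
        (\<lambda>p. metric_inverse E g p (E_differential E \<rho> (\<lambda>q. g q (u q) (v q)) p)))"


section \<open>Linear E-connections\<close>

definition linear_E_connection ::
    "('m :: {t2_space, second_countable_topology}) smooth_structure \<Rightarrow>
     ('m, 'e :: real_vector) vbundle \<Rightarrow> ('m \<Rightarrow> 'e \<Rightarrow> ('m \<Rightarrow> real) \<Rightarrow> real) \<Rightarrow>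
     (('m \<Rightarrow> 'e) \<Rightarrow> ('m \<Rightarrow> 'e) \<Rightarrow> 'm \<Rightarrow> 'e) \<Rightarrow> bool" where
  "linear_E_connection M E \<rho> nab \<longleftrightarrow>
     real_bilinear_on_sections M E nab \<and>
     (\<forall>f\<in>smooth_functions M. \<forall>u\<in>sections M E. \<forall>v\<in>sections M E.
        nab u (\<lambda>p. f p *\<^sub>R v p) = (\<lambda>p. \<rho> p (u p) f *\<^sub>R v p + f p *\<^sub>R nab u v p) \<and>
        nab (\<lambda>p. f p *\<^sub>R u p) v = (\<lambda>p. f p *\<^sub>R nab u v p))"

text \<open>A connection is linear over smooth functions in its first argument, and a locality operator in
  all three. Their values at \<open>p\<close> therefore depend on these arguments only through their values at \<open>p\<close>;
  this is how they are applied to local frames and coframes, which need not extend to global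
  sections.\<close>

definition connection_at ::
    "('m :: {t2_space, second_countable_topology}) smooth_structure \<Rightarrow>
     ('m, 'e :: real_vector) vbundle \<Rightarrow> (('m \<Rightarrow> 'e) \<Rightarrow> ('m \<Rightarrow> 'e) \<Rightarrow> 'm \<Rightarrow> 'e) \<Rightarrow>
     'm \<Rightarrow> 'e \<Rightarrow> ('m \<Rightarrow> 'e) \<Rightarrow> 'e" where
  "connection_at M E nab p x u = (THE z. \<exists>w\<in>sections M E. w p = x \<and> z = nab w u p)"

definition locality_at ::
    "('m :: {t2_space, second_countable_topology}) smooth_structure \<Rightarrow>
     ('m, 'e :: real_vector) vbundle \<Rightarrow>
     (('m \<Rightarrow> 'e \<Rightarrow> real) \<Rightarrow> ('m \<Rightarrow> 'e) \<Rightarrow> ('m \<Rightarrow> 'e) \<Rightarrow> 'm \<Rightarrow> 'e) \<Rightarrow>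
     'm \<Rightarrow> ('e \<Rightarrow> real) \<Rightarrow> 'e \<Rightarrow> 'e \<Rightarrow> 'e" where
  "locality_at M E L p \<alpha> x y =
     (THE z. \<exists>\<Omega>\<in>one_forms M E. \<exists>u\<in>sections M E. \<exists>v\<in>sections M E.
        \<Omega> p = \<alpha> \<and> u p = x \<and> v p = y \<and> z = L \<Omega> u v p)"

definition admissible ::
    "('m :: {t2_space, second_countable_topology}) smooth_structure \<Rightarrow>
     ('m, 'e :: real_vector) vbundle \<Rightarrow> (('m \<Rightarrow> 'e) \<Rightarrow> ('m \<Rightarrow> 'e) \<Rightarrow> 'm \<Rightarrow> 'e) \<Rightarrow>
     (('m \<Rightarrow> 'e \<Rightarrow> real) \<Rightarrow> ('m \<Rightarrow> 'e) \<Rightarrow> ('m \<Rightarrow> 'e) \<Rightarrow> 'm \<Rightarrow> 'e) \<Rightarrow>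
     (('m \<Rightarrow> 'e) \<Rightarrow> ('m \<Rightarrow> 'e) \<Rightarrow> 'm \<Rightarrow> 'e) \<Rightarrow> bool" where
  "admissible M E br L nab \<longleftrightarrow>
     (\<forall>u\<in>sections M E. \<forall>v\<in>sections M E. \<forall>U X. local_frame M E U X \<longrightarrow>
        (\<forall>p\<in>U. br u v p + br v u p =
           (\<Sum>a<bundle_rank E.
              locality_at M E L p (dual_coframe E X a p) (connection_at M E nab p (X a p) u) (v p) +
              locality_at M E L p (dual_coframe E X a p) (connection_at M E nab p (X a p) v) (u p))))"

definition metric_locality_operator ::
    "('m, 'e :: real_vector) vbundle \<Rightarrow> ('m \<Rightarrow> 'e \<Rightarrow> 'e \<Rightarrow> real) \<Rightarrow>
     ('m \<Rightarrow> 'e \<Rightarrow> real) \<Rightarrow> ('m \<Rightarrow> 'e) \<Rightarrow> ('m \<Rightarrow> 'e) \<Rightarrow> 'm \<Rightarrow> 'e" where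
  "metric_locality_operator E g \<Omega> u v = (\<lambda>p. g p (u p) (v p) *\<^sub>R metric_inverse E g p (\<Omega> p))"

definition metric_compatible ::
    "('m :: {t2_space, second_countable_topology}) smooth_structure \<Rightarrow>
     ('m, 'e :: real_vector) vbundle \<Rightarrow> ('m \<Rightarrow> 'e \<Rightarrow> ('m \<Rightarrow> real) \<Rightarrow> real) \<Rightarrow>
     ('m \<Rightarrow> 'e \<Rightarrow> 'e \<Rightarrow> real) \<Rightarrow> (('m \<Rightarrow> 'e) \<Rightarrow> ('m \<Rightarrow> 'e) \<Rightarrow> 'm \<Rightarrow> 'e) \<Rightarrow> bool" where
  "metric_compatible M E \<rho> g nab \<longleftrightarrow>
     (\<forall>u\<in>sections M E. \<forall>v\<in>sections M E. \<forall>w\<in>sections M E. \<forall>p.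
        \<rho> p (w p) (\<lambda>q. g q (u q) (v q)) = g p (nab w u p) (v p) + g p (u p) (nab w v p))"

end

theory Submission
  imports Defs
begin

text \<open>Pair the admissibility condition at \<open>p\<close> with a vector \<open>w(p)\<close>. By the Courant axiom the left-hand
  side becomes \<open>\<rho>(w)(g(u,v))\<close>; since \<open>g(g\<inverse>(e\<^sup>a), w) = e\<^sup>a(w)\<close> and \<open>\<nabla>\<close> is tensorial in its first argument, the
  right-hand side becomes \<open>g(\<nabla>\<^sub>w u, v) + g(u, \<nabla>\<^sub>w v)\<close>. Non-degeneracy of \<open>g\<close> gives the equivalence. Bump
  functions are needed to see that \<open>(\<nabla>\<^sub>w u)(p)\<close> depends on \<open>w(p)\<close> only, and that every vector and
  covector at \<open>p\<close> is the value of a global section and of a global one-form.\<close>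

section \<open>Closure properties of smooth functions\<close>

text \<open>\<open>connection_at\<close>, \<open>locality_at\<close> and
  \<open>metric_inverse\<close> are definite descriptions, so \<open>admissible\<close> says nothing
  until each of them is shown to have exactly one value. For the connection the point is uniqueness,
  which is tensoriality; for the metric locality operator uniqueness is visible from the formula and
  the point is existence; for the inverse metric existence is a dimension count in the fibre. After
  that, the frame enters only through the expansion of a vector in the frame, and it cancels from
  the paired condition. Hence one frame around \<open>p\<close> suffices to derive compatibility,
  while compatibility gives the condition in every frame. Smoothness is defined by iterated
  \<open>deriv\<close>, whose values off the open set \<open>V\<close> carry no information. Its
  closure properties are therefore proved by coinduction: a class of functions is exhibited that
  contains partial derivatives of its members, and functions are compared on \<open>V\<close>
  only.\<close>

lemma openin_Euclidean_space_iff: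
  "openin (Euclidean_space n) V \<longleftrightarrow> (\<exists>T. open T \<and> V = T \<inter> {x. \<forall>i\<ge>n. x i = 0})"
  unfolding Euclidean_space_def by (simp add: openin_subtopology euclidean_product_topology)

text \<open>\<open>V\<close> is only relatively open in the space of all sequences. Changing a
  coordinate below \<open>n\<close> stays in n-space, so a short piece of each such coordinate line
  still lies in \<open>V\<close>.\<close>

lemma eventually_fun_upd_in_open:
  assumes V: "openin (Euclidean_space n) V" and "x \<in> V" and "i < n"
  shows "\<forall>\<^sub>F t in nhds (x i). x(i := t) \<in> V"
proof -
  obtain T where T: "open T" "V = T \<inter> {x. \<forall>i\<ge>n. x i = 0}"
    using V by (auto simp: openin_Euclidean_space_iff)
  have "continuous_on UNIV (\<lambda>t. (x(i := t)) j)" for j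
    by (cases "j = i") auto
  then have "continuous_on UNIV (\<lambda>t. x(i := t))"
    by (rule continuous_on_coordinatewise_then_product)
  then have "open ((\<lambda>t. x(i := t)) -` T)"
    using T(1) by (simp add: continuous_on_open_vimage)
  moreover have "x i \<in> (\<lambda>t. x(i := t)) -` T"
    using assms(2) T by simp
  ultimately have "\<forall>\<^sub>F t in nhds (x i). t \<in> (\<lambda>t. x(i := t)) -` T"
    by (rule eventually_nhds_in_open)
  then show ?thesis
    by eventually_elim (use assms T in auto)
qed

lemma iterated_partial_append:
  "iterated_partial (is @ js) f = iterated_partial is (iterated_partial js f)"
  by (induction "is") auto

text \<open>Each \<open>iterated_partial\<close> agrees on \<open>V\<close> with some member of the
  class \<open>P\<close>. Agreement on \<open>V\<close> passes to derivatives because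
  \<open>V\<close> contains a neighbourhood of each of its points on every coordinate line.\<close>

lemma smooth_Rn_coinduct:
  assumes V: "openin (Euclidean_space n) V" and "P f"
    and cont: "\<And>f. P f \<Longrightarrow> continuous_on V f"
    and step: "\<And>f i. P f \<Longrightarrow> i < n \<Longrightarrow>
      \<exists>f'. P f' \<and> (\<forall>x\<in>V. ((\<lambda>t. f (x(i := t))) has_real_derivative f' x) (at (x i)))"
  shows "smooth_Rn n V f"
proof -
  have transfer: "((\<lambda>t. h (x(i := t))) has_real_derivative D) (at (x i))"
    if "((\<lambda>t. k (x(i := t))) has_real_derivative D) (at (x i))" "\<forall>x\<in>V. h x = k x" "x \<in> V" "i < n"
    for h k :: "(nat \<Rightarrow> real) \<Rightarrow> real" and x i D
  proof -
    have "\<forall>\<^sub>F t in nhds (x i). h (x(i := t)) = k (x(i := t))"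
      using eventually_fun_upd_in_open[OF V that(3,4)] by eventually_elim (use that(2) in auto)
    then show ?thesis
      using that(1) by (subst DERIV_cong_ev[OF refl _ refl]) auto
  qed
  have *: "\<exists>h. P h \<and> (\<forall>x\<in>V. iterated_partial js f x = h x)" if "set js \<subseteq> {..<n}" for js
    using that
  proof (induction js)
    case Nil
    then show ?case using \<open>P f\<close> by auto
  next
    case (Cons i js)
    then obtain h where h: "P h" "\<forall>x\<in>V. iterated_partial js f x = h x" and i: "i < n"
      by auto
    obtain h' where h': "P h'"
      "\<forall>x\<in>V. ((\<lambda>t. h (x(i := t))) has_real_derivative h' x) (at (x i))"
      using step[OF h(1) i] by blast
    have "iterated_partial (i # js) f x = h' x" if "x \<in> V" for x
      using transfer[OF _ h(2) that i] h'(2) that by (auto intro!: DERIV_imp_deriv)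
    then show ?case using h'(1) by blast
  qed
  show ?thesis
    unfolding smooth_Rn_def
  proof (intro allI impI conjI ballI)
    fix js assume "set js \<subseteq> {..<n}"
    then obtain h where h: "P h" "\<forall>x\<in>V. iterated_partial js f x = h x"
      using * by blast
    show "continuous_on V (iterated_partial js f)"
      using cont[OF h(1)] h(2) by (simp cong: continuous_on_cong)
    fix x i assume x: "x \<in> V" and i: "i < n"
    obtain h' where h': "\<forall>x\<in>V. ((\<lambda>t. h (x(i := t))) has_real_derivative h' x) (at (x i))"
      using step[OF h(1) i] by blast
    show "(\<lambda>t. iterated_partial js f (x(i := t))) differentiable at (x i)"
      using transfer[OF _ h(2) x i] h' x by (auto simp: real_differentiable_def)
  qed
qed

lemma smooth_Rn_imp_continuous_on: "smooth_Rn n V f \<Longrightarrow> continuous_on V f"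
  unfolding smooth_Rn_def by (auto dest!: spec[of _ "[]"])

lemma smooth_Rn_partial:
  assumes "smooth_Rn n V f" and "i < n"
  shows "\<exists>f'. smooth_Rn n V f' \<and>
    (\<forall>x\<in>V. ((\<lambda>t. f (x(i := t))) has_real_derivative f' x) (at (x i)))"
proof (intro exI conjI ballI)
  \<comment> \<open>\<open>iterated_partial\<close> applies its list from the right, so the
    derivatives of the i-th partial derivative are those whose list ends in
    \<open>i\<close>.\<close>
  have "set js \<subseteq> {..<n} \<Longrightarrow> set (js @ [i]) \<subseteq> {..<n}" for js
    using assms(2) by auto
  then show "smooth_Rn n V (iterated_partial [i] f)"
    using assms(1) unfolding smooth_Rn_def iterated_partial_append[symmetric] by blast
next
  fix x assume "x \<in> V"
  then have "(\<lambda>t. f (x(i := t))) differentiable (at (x i))"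
    using assms unfolding smooth_Rn_def by (auto dest!: spec[of _ "[]"])
  then show "((\<lambda>t. f (x(i := t))) has_real_derivative iterated_partial [i] f x) (at (x i))"
    by (simp add: DERIV_deriv_iff_real_differentiable)
qed

text \<open>Coinduction for the class of functions that agree on \<open>V\<close> with some smooth
  function.\<close>

lemma smooth_Rn_cong:
  assumes V: "openin (Euclidean_space n) V" and f: "smooth_Rn n V f" and eq: "\<And>x. x \<in> V \<Longrightarrow> f x = h x"
  shows "smooth_Rn n V h"
proof (rule smooth_Rn_coinduct[OF V, where P = "\<lambda>h. \<exists>f. smooth_Rn n V f \<and> (\<forall>x\<in>V. f x = h x)"])
  show "\<exists>f. smooth_Rn n V f \<and> (\<forall>x\<in>V. f x = h x)"
    using f eq by blast
next
  fix h assume "\<exists>f. smooth_Rn n V f \<and> (\<forall>x\<in>V. f x = h x)"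
  then show "continuous_on V h"
    using smooth_Rn_imp_continuous_on by (metis continuous_on_cong)
next
  fix h i assume "\<exists>f. smooth_Rn n V f \<and> (\<forall>x\<in>V. f x = h x)" and i: "i < n"
  then obtain f where f: "smooth_Rn n V f" and eq: "\<forall>x\<in>V. f x = h x"
    by blast
  obtain f' where f': "smooth_Rn n V f'"
    "\<forall>x\<in>V. ((\<lambda>t. f (x(i := t))) has_real_derivative f' x) (at (x i))"
    using smooth_Rn_partial[OF f i] by blast
  have "((\<lambda>t. h (x(i := t))) has_real_derivative f' x) (at (x i))" if "x \<in> V" for x
  proof -
    have "\<forall>\<^sub>F t in nhds (x i). f (x(i := t)) = h (x(i := t))"
      using eventually_fun_upd_in_open[OF V that i] by eventually_elim (use eq in auto)
    then show ?thesis
      using f'(2) that by (subst DERIV_cong_ev[OF refl _ refl, symmetric]) auto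
  qed
  then show "\<exists>h'. (\<exists>f. smooth_Rn n V f \<and> (\<forall>x\<in>V. f x = h' x)) \<and>
      (\<forall>x\<in>V. ((\<lambda>t. h (x(i := t))) has_real_derivative h' x) (at (x i)))"
    using f'(1) by blast
qed

lemma smooth_Rn_subset: "smooth_Rn n V f \<Longrightarrow> W \<subseteq> V \<Longrightarrow> smooth_Rn n W f"
  unfolding smooth_Rn_def by (meson continuous_on_subset subsetD)

lemma smooth_Rn_Un:
  assumes "openin (Euclidean_space n) V" and "openin (Euclidean_space n) W"
    and "smooth_Rn n V f" and "smooth_Rn n W f"
  shows "smooth_Rn n (V \<union> W) f"
proof -
  have "openin (top_of_set (V \<union> W)) V" "openin (top_of_set (V \<union> W)) W"
    using assms(1,2) unfolding openin_Euclidean_space_iff openin_open by auto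
  then show ?thesis
    using assms(3,4) unfolding smooth_Rn_def by (auto intro!: continuous_on_Un_local_open)
qed

section \<open>Flat functions and closure under composition with them\<close>

definition flat :: "nat \<Rightarrow> real \<Rightarrow> real" where
  "flat k t = (if t \<le> 0 then 0 else exp (- inverse t) * inverse t ^ k)"

text \<open>With s = 1/t the limit from the right becomes that of s^k / exp s at infinity.\<close>

lemma flat_tendsto_0: "(flat k \<longlongrightarrow> 0) (at 0)"
proof (rule filterlim_split_at)
  have "\<forall>\<^sub>F t in at_left 0. flat k t = 0"
    by (simp add: flat_def eventually_at_left_field) (use linordered_field_no_lb in blast)
  then show "(flat k \<longlongrightarrow> 0) (at_left 0)"
    by (simp add: tendsto_eventually)
  have "((\<lambda>t. inverse t ^ k / exp (inverse t)) \<longlongrightarrow> (0 :: real)) (at_right 0)"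
    by (rule filterlim_compose[OF tendsto_power_div_exp_0 filterlim_inverse_at_top_right])
  moreover have "\<forall>\<^sub>F t in at_right 0. inverse t ^ k / exp (inverse t) = flat k t"
    by (rule eventually_at_rightI[of 0 1]) (auto simp: flat_def exp_minus field_simps)
  ultimately show "(flat k \<longlongrightarrow> 0) (at_right 0)"
    by (rule Lim_transform_eventually)
qed

lemma flat_has_real_derivative:
  "(flat k has_real_derivative flat (k + 2) t - real k * flat (k + 1) t) (at t)"
proof -
  consider "t < 0" | "t = 0" | "t > 0" by linarith
  then show ?thesis
  proof cases
    case 1
    then have "\<forall>\<^sub>F s in nhds t. flat k s = 0"
      using eventually_nhds_in_open[of "{..<0}" t]
      by (auto elim!: eventually_mono simp: flat_def)
    then show ?thesis
      using 1 by (subst DERIV_cong_ev[OF refl _ refl]) (auto simp: flat_def)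
  next
    case 2
    \<comment> \<open>The difference quotient of \<open>flat k\<close> at 0 is
      \<open>flat (k + 1)\<close> itself, so the limit already known gives the derivative.\<close>
    have "\<forall>\<^sub>F h in at 0. flat (k + 1) h = (flat k (0 + h) - flat k 0) / h"
      by (auto simp: flat_def eventually_at_filter field_simps)
    with flat_tendsto_0[of "k + 1"] have "((\<lambda>h. (flat k (0 + h) - flat k 0) / h) \<longlongrightarrow> 0) (at 0)"
      by (rule Lim_transform_eventually)
    then show ?thesis
      using 2 by (simp add: DERIV_def flat_def)
  next
    case 3
    then have "\<forall>\<^sub>F s in nhds t. flat k s = exp (- inverse s) * inverse s ^ k"
      using eventually_nhds_in_open[of "{0<..}" t]
      by (auto elim!: eventually_mono simp: flat_def)
    moreover have "((\<lambda>s. exp (- inverse s) * inverse s ^ k) has_real_derivative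
        flat (k + 2) t - real k * flat (k + 1) t) (at t)"
    proof (cases k)
      case 0
      then show ?thesis
        using 3 by (auto intro!: derivative_eq_intros simp: flat_def power2_eq_square)
    next
      case (Suc j)
      then show ?thesis
        using 3
        by (auto intro!: derivative_eq_intros
            simp: flat_def power2_eq_square algebra_simps power_eq_if[of "inverse t" j])
    qed
    ultimately show ?thesis
      by (subst DERIV_cong_ev[OF refl _ refl]) auto
  qed
qed

lemma isCont_flat: "isCont (flat k) t"
  by (rule DERIV_isCont[OF flat_has_real_derivative])

text \<open>Closed under partial derivatives because the derivative of each \<^const>\<open>flat\<close> function is a
  linear combination of two further ones; a general chain rule is therefore not needed.\<close>

inductive smooth_closure :: "nat \<Rightarrow> (nat \<Rightarrow> real) set \<Rightarrow> ((nat \<Rightarrow> real) \<Rightarrow> real) \<Rightarrow> bool" for n V where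
  base: "smooth_Rn n V f \<Longrightarrow> smooth_closure n V f"
| const: "smooth_closure n V (\<lambda>x. c)"
| add: "smooth_closure n V f \<Longrightarrow> smooth_closure n V h \<Longrightarrow> smooth_closure n V (\<lambda>x. f x + h x)"
| mult: "smooth_closure n V f \<Longrightarrow> smooth_closure n V h \<Longrightarrow> smooth_closure n V (\<lambda>x. f x * h x)"
| flat: "smooth_closure n V f \<Longrightarrow> smooth_closure n V (\<lambda>x. flat k (f x))"

lemma smooth_closure_partial:
  assumes "smooth_closure n V f" and "i < n"
  shows "\<exists>f'. smooth_closure n V f' \<and>
    (\<forall>x\<in>V. ((\<lambda>t. f (x(i := t))) has_real_derivative f' x) (at (x i)))"
  using assms(1)
proof induction
  case (base f)
  then show ?case
    using smooth_Rn_partial[OF base assms(2)] smooth_closure.base by blast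
next
  case (const c)
  show ?case
    by (intro exI[of _ "\<lambda>x. 0"]) (auto intro: smooth_closure.const)
next
  case (add f h)
  then obtain f' h' where *:
    "smooth_closure n V f'" "\<forall>x\<in>V. ((\<lambda>t. f (x(i := t))) has_real_derivative f' x) (at (x i))"
    "smooth_closure n V h'" "\<forall>x\<in>V. ((\<lambda>t. h (x(i := t))) has_real_derivative h' x) (at (x i))"
    by blast
  show ?case
    by (intro exI[of _ "\<lambda>x. f' x + h' x"] conjI ballI smooth_closure.add DERIV_add) (use * in blast)+
next
  case (mult f h)
  then obtain f' h' where *:
    "smooth_closure n V f'" "\<forall>x\<in>V. ((\<lambda>t. f (x(i := t))) has_real_derivative f' x) (at (x i))"
    "smooth_closure n V h'" "\<forall>x\<in>V. ((\<lambda>t. h (x(i := t))) has_real_derivative h' x) (at (x i))"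
    by blast
  show ?case
  proof (intro exI conjI ballI)
    show "smooth_closure n V (\<lambda>x. f' x * h x + h' x * f x)"
      using mult.hyps *(1,3) by (intro smooth_closure.intros(3,4))
    fix x assume "x \<in> V"
    then show "((\<lambda>t. f (x(i := t)) * h (x(i := t))) has_real_derivative f' x * h x + h' x * f x) (at (x i))"
      using *(2,4) DERIV_mult[of "\<lambda>t. f (x(i := t))" "f' x" "x i" UNIV "\<lambda>t. h (x(i := t))" "h' x"]
      by simp
  qed
next
  case (flat f k)
  then obtain f' where f':
    "smooth_closure n V f'" "\<forall>x\<in>V. ((\<lambda>t. f (x(i := t))) has_real_derivative f' x) (at (x i))"
    by blast
  show ?case
  \<comment> \<open>The difference is spelled with a constant factor \<open>- real k\<close>, since
    \<open>smooth_closure\<close> is generated by sums and products.\<close>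
  proof (intro exI[of _ "\<lambda>x. (flat (k + 2) (f x) + (- real k) * flat (k + 1) (f x)) * f' x"] conjI ballI)
    show "smooth_closure n V (\<lambda>x. (flat (k + 2) (f x) + (- real k) * flat (k + 1) (f x)) * f' x)"
      using flat.hyps f'(1) by (intro smooth_closure.intros(2-))
    fix x assume "x \<in> V"
    then show "((\<lambda>t. flat k (f (x(i := t)))) has_real_derivative
        (flat (k + 2) (f x) + (- real k) * flat (k + 1) (f x)) * f' x) (at (x i))"
      using DERIV_chain2[OF flat_has_real_derivative] f'(2) by fastforce
  qed
qed

lemma smooth_closure_imp_continuous_on: "smooth_closure n V f \<Longrightarrow> continuous_on V f"
proof (induction rule: smooth_closure.induct)
  case (flat f k)
  have "continuous_on UNIV (flat k)"
    by (simp add: continuous_at_imp_continuous_on isCont_flat)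
  with flat show ?case
    using continuous_on_compose2 by blast
qed (auto intro: smooth_Rn_imp_continuous_on continuous_intros)

lemma smooth_closure_imp_smooth_Rn:
  assumes "openin (Euclidean_space n) V" and "smooth_closure n V f"
  shows "smooth_Rn n V f"
  using smooth_Rn_coinduct[where P = "smooth_closure n V", OF assms]
    smooth_closure_imp_continuous_on smooth_closure_partial by blast

section \<open>Compact boxes in n-space\<close>

lemma box_subset_open:
  assumes "openin (Euclidean_space n) V" and "x \<in> V"
  obtains \<epsilon> where "\<epsilon> > 0" "{y. (\<forall>i<n. \<bar>y i - x i\<bar> \<le> \<epsilon>) \<and> (\<forall>i\<ge>n. y i = 0)} \<subseteq> V"
proof -
  obtain T where T: "open T" "V = T \<inter> {x. \<forall>i\<ge>n. x i = 0}"
    using assms(1) by (auto simp: openin_Euclidean_space_iff)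
  then have "openin (powertop_real UNIV) T" "x \<in> T"
    using assms(2) by (auto simp: euclidean_product_topology)
  from product_topology_open_contains_basis[OF this] obtain X where
    X: "x \<in> PiE UNIV X" "\<And>i. open (X i)" "PiE UNIV X \<subseteq> T"
    by auto
  have "\<exists>e>0. cball (x i) e \<subseteq> X i" for i
    using X(1,2) by (auto simp: PiE_UNIV_domain open_contains_cball)
  then obtain e where e: "\<And>i. e i > 0" "\<And>i. cball (x i) (e i) \<subseteq> X i"
    by metis
  \<comment> \<open>Only coordinates below \<open>n\<close> need a common radius, as all later ones
    are 0 for both points. The 1 keeps the set nonempty when \<open>n\<close> is 0.\<close>
  define \<epsilon> where "\<epsilon> = Min (insert 1 (e ` {..<n}))"
  have "\<epsilon> > 0" unfolding \<epsilon>_def using e(1) by (subst Min_gr_iff) auto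
  moreover have "y \<in> V" if y: "\<forall>i<n. \<bar>y i - x i\<bar> \<le> \<epsilon>" "\<forall>i\<ge>n. y i = 0" for y
  proof -
    have "y i \<in> X i" for i
    proof (cases "i < n")
      case True
      then have "\<epsilon> \<le> e i" unfolding \<epsilon>_def by (intro Min_le) auto
      with True y have "y i \<in> cball (x i) (e i)"
        by (force simp: dist_real_def abs_minus_commute)
      then show ?thesis using e(2) by blast
    next
      case False
      then have "y i = x i" using y(2) T(2) assms(2) by auto
      then show ?thesis using X(1) by (auto simp: PiE_UNIV_domain)
    qed
    then have "y \<in> T" using X(3) by (auto simp: PiE_UNIV_domain)
    with T(2) y(2) show ?thesis by auto
  qed
  ultimately show thesis using that by blast
qed

text \<open>In the space of sequences compactness comes from Tychonoff's theorem: each factor is a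
  closed ball of the real line or, from \<open>n\<close> on, the singleton of 0.\<close>

lemma compact_box: "compact {y :: nat \<Rightarrow> real. (\<forall>i<n. \<bar>y i - x i\<bar> \<le> \<epsilon>) \<and> (\<forall>i\<ge>n. y i = 0)}"
proof -
  have "y i \<in> (if i < n then cball (x i) \<epsilon> else {0}) \<longleftrightarrow>
      (i < n \<longrightarrow> \<bar>y i - x i\<bar> \<le> \<epsilon>) \<and> (i \<ge> n \<longrightarrow> y i = 0)" for y i
    by (auto simp: dist_real_def abs_minus_commute)
  then have eq: "{y. (\<forall>i<n. \<bar>y i - x i\<bar> \<le> \<epsilon>) \<and> (\<forall>i\<ge>n. y i = 0)} =
      PiE UNIV (\<lambda>i. if i < n then cball (x i) \<epsilon> else {0})"
    by (auto simp: PiE_UNIV_domain Pi_iff)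
  have "compactin (powertop_real UNIV) (PiE UNIV (\<lambda>i. if i < n then cball (x i) \<epsilon> else {0}))"
    unfolding compactin_PiE by auto
  then show ?thesis
    by (simp add: eq euclidean_product_topology)
qed

section \<open>Smooth functions on a manifold\<close>

lemma smooth_manifold_chartD:
  assumes "smooth_manifold M" and "(U, \<phi>) \<in> atlas M"
  shows "open U" and "openin (Euclidean_space (dimension M)) (\<phi> ` U)"
    and "homeomorphic_map (top_of_set U) (subtopology (Euclidean_space (dimension M)) (\<phi> ` U)) \<phi>"
    and "inj_on \<phi> U"
proof -
  have "\<forall>(U, \<phi>)\<in>atlas M. open U \<and> openin (Euclidean_space (dimension M)) (\<phi> ` U) \<and>
      homeomorphic_map (top_of_set U) (subtopology (Euclidean_space (dimension M)) (\<phi> ` U)) \<phi>"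
    using assms(1) unfolding smooth_manifold_def by (elim conjE)
  with assms(2) show "open U" "openin (Euclidean_space (dimension M)) (\<phi> ` U)"
    and hom: "homeomorphic_map (top_of_set U) (subtopology (Euclidean_space (dimension M)) (\<phi> ` U)) \<phi>"
    by auto
  show "inj_on \<phi> U"
    using homeomorphic_imp_injective_map[OF hom] by simp
qed

lemma chart_image_open:
  assumes "smooth_manifold M" and "(U, \<phi>) \<in> atlas M" and "open W"
  shows "openin (Euclidean_space (dimension M)) (\<phi> ` (U \<inter> W))"
proof -
  have "openin (top_of_set U) (U \<inter> W)"
    using assms(3) by (simp add: openin_open_Int)
  then have "openin (subtopology (Euclidean_space (dimension M)) (\<phi> ` U)) (\<phi> ` (U \<inter> W))"
    using homeomorphic_imp_open_map[OF smooth_manifold_chartD(3)[OF assms(1,2)]]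
    unfolding open_map_def by blast
  then show ?thesis
    using smooth_manifold_chartD(2)[OF assms(1,2)] openin_trans_full by blast
qed

lemma smooth_on_subset: "smooth_on M W f \<Longrightarrow> W' \<subseteq> W \<Longrightarrow> smooth_on M W' f"
  unfolding smooth_on_def by (blast intro: smooth_Rn_subset)

lemma smooth_on_cong:
  assumes M: "smooth_manifold M" and W: "open W" and f: "smooth_on M W f"
    and eq: "\<And>q. q \<in> W \<Longrightarrow> f q = h q"
  shows "smooth_on M W h"
  unfolding smooth_on_def
proof safe
  fix U \<phi> assume U: "(U, \<phi>) \<in> atlas M"
  then have "smooth_Rn (dimension M) (\<phi> ` (U \<inter> W)) (\<lambda>x. f (inv_into U \<phi> x))"
    using f unfolding smooth_on_def by blast
  then show "smooth_Rn (dimension M) (\<phi> ` (U \<inter> W)) (\<lambda>x. h (inv_into U \<phi> x))"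
    by (rule smooth_Rn_cong[OF chart_image_open[OF M U W]])
      (use eq smooth_manifold_chartD(4)[OF M U] in auto)
qed

lemma smooth_on_Un:
  assumes "smooth_manifold M" and "open W" "open W'" and "smooth_on M W f" "smooth_on M W' f"
  shows "smooth_on M (W \<union> W') f"
  using assms unfolding smooth_on_def
  by (auto simp: Int_Un_distrib image_Un intro!: smooth_Rn_Un chart_image_open)

text \<open>The open sets \<open>V \<inter> W\<close> and \<open>V - K\<close> cover
  \<open>V\<close>, and \<open>f\<close> is zero on the second. This is what makes extensions by
  zero smooth.\<close>

lemma smooth_on_glue_zero:
  assumes M: "smooth_manifold M" and "open W" "closed K" "K \<subseteq> W" and f: "smooth_on M (V \<inter> W) f"
    and "open V" and zero: "\<And>q. q \<in> V - K \<Longrightarrow> f q = 0"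
    and const: "smooth_on M (V - K) (\<lambda>q. 0)"
  shows "smooth_on M V f"
proof -
  have "smooth_on M (V - K) f"
    using smooth_on_cong[OF M _ const] assms by auto
  then have "smooth_on M (V \<inter> W \<union> (V - K)) f"
    using assms by (intro smooth_on_Un) auto
  moreover have "V \<inter> W \<union> (V - K) = V"
    using assms by auto
  ultimately show ?thesis by simp
qed

lemma smooth_closure_chart:
  assumes "smooth_on M W f" and "(U, \<phi>) \<in> atlas M"
  shows "smooth_closure (dimension M) (\<phi> ` (U \<inter> W)) (\<lambda>x. f (inv_into U \<phi> x))"
  using assms unfolding smooth_on_def by (auto intro: smooth_closure.base)

lemma smooth_on_const:
  assumes "smooth_manifold M" and "open W"
  shows "smooth_on M W (\<lambda>q. c)"
  unfolding smooth_on_def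
  using assms by (auto intro!: smooth_closure_imp_smooth_Rn chart_image_open smooth_closure.const)

lemma smooth_on_add:
  assumes "smooth_manifold M" and "open W" and "smooth_on M W f" and "smooth_on M W h"
  shows "smooth_on M W (\<lambda>q. f q + h q)"
  unfolding smooth_on_def using assms
  by (auto intro!: smooth_closure_imp_smooth_Rn chart_image_open smooth_closure.add
      intro: smooth_closure_chart)

lemma smooth_on_mult:
  assumes "smooth_manifold M" and "open W" and "smooth_on M W f" and "smooth_on M W h"
  shows "smooth_on M W (\<lambda>q. f q * h q)"
  unfolding smooth_on_def using assms
  by (auto intro!: smooth_closure_imp_smooth_Rn chart_image_open smooth_closure.mult
      intro: smooth_closure_chart)

lemma smooth_on_flat:
  assumes "smooth_manifold M" and "open W" and "smooth_on M W f"
  shows "smooth_on M W (\<lambda>q. flat k (f q))"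
  unfolding smooth_on_def using assms
  by (auto intro!: smooth_closure_imp_smooth_Rn chart_image_open smooth_closure.flat
      intro: smooth_closure_chart)

lemma smooth_on_prod:
  assumes "smooth_manifold M" and "open W" and "\<And>i. i \<in> I \<Longrightarrow> smooth_on M W (f i)"
  shows "smooth_on M W (\<lambda>q. \<Prod>i\<in>I. f i q)"
  using assms(3)
  by (induction I rule: infinite_finite_induct)
    (auto intro!: smooth_on_const smooth_on_mult assms(1,2))

lemma smooth_on_chart_coordinate:
  assumes "smooth_manifold M" and "(V, \<psi>) \<in> atlas M" and "i < dimension M"
  shows "smooth_on M V (\<lambda>q. \<psi> q i)"
proof -
  have "\<forall>(U, \<phi>)\<in>atlas M. \<forall>(V, \<psi>)\<in>atlas M. \<forall>i<dimension M.
      smooth_Rn (dimension M) (\<phi> ` (U \<inter> V)) (\<lambda>x. \<psi> (inv_into U \<phi> x) i)"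
    using assms(1) unfolding smooth_manifold_def by (elim conjE)
  then show ?thesis
    using assms(2,3) unfolding smooth_on_def by blast
qed

text \<open>In a chart, the product of the functions \<open>flat 0 (\<epsilon>\<^sup>2 - (\<phi> q i
  - \<phi> p i)\<^sup>2)\<close> vanishes outside a box around \<open>\<phi> p\<close>. The preimage
  \<open>K\<close> of the box must be closed in the whole manifold and not only in the chart domain;
  it is, being compact in a Hausdorff space.\<close>

lemma bump_function_exists:
  assumes M: "smooth_manifold M" and W: "open W" "p \<in> W"
  obtains \<beta> K where "\<beta> \<in> smooth_functions M" "\<beta> p = 1" "closed K" "K \<subseteq> W" "\<And>q. q \<notin> K \<Longrightarrow> \<beta> q = 0"
proof -
  let ?n = "dimension M"
  have "(\<Union>(U, \<phi>)\<in>atlas M. U) = UNIV"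
    using M unfolding smooth_manifold_def by (elim conjE)
  then have "p \<in> (\<Union>(U, \<phi>)\<in>atlas M. U)"
    by simp
  then obtain V \<phi> where V: "(V, \<phi>) \<in> atlas M" "p \<in> V"
    by auto
  note chart = smooth_manifold_chartD[OF M V(1)]
  have "openin (Euclidean_space ?n) (\<phi> ` (V \<inter> W))" "\<phi> p \<in> \<phi> ` (V \<inter> W)"
    using chart_image_open[OF M V(1) W(1)] V(2) W(2) by auto
  then obtain \<epsilon> where \<epsilon>: "\<epsilon> > 0" and
    sub: "{y. (\<forall>i<?n. \<bar>y i - \<phi> p i\<bar> \<le> \<epsilon>) \<and> (\<forall>i\<ge>?n. y i = 0)} \<subseteq> \<phi> ` (V \<inter> W)"
    by (rule box_subset_open)
  define B where "B = {y. (\<forall>i<?n. \<bar>y i - \<phi> p i\<bar> \<le> \<epsilon>) \<and> (\<forall>i\<ge>?n. y i = 0)}"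
  define K where "K = {q \<in> V. \<phi> q \<in> B}"
  have BV: "B \<subseteq> \<phi> ` (V \<inter> W)"
    using sub by (simp add: B_def)
  have "q \<in> W" if "q \<in> K" for q
  proof -
    obtain q' where "q' \<in> V" "q' \<in> W" "\<phi> q = \<phi> q'"
      using BV \<open>q \<in> K\<close> unfolding K_def by blast
    then show ?thesis
      using inj_onD[OF chart(4)] \<open>q \<in> K\<close> unfolding K_def by auto
  qed
  then have "K \<subseteq> W" ..
  have im: "\<phi> ` K = B"
    using BV unfolding K_def by blast
  have "compactin (Euclidean_space ?n) B"
    unfolding Euclidean_space_def euclidean_product_topology compactin_subtopology
    using compact_box[of ?n "\<phi> p" \<epsilon>] unfolding B_def by auto
  then have "compactin (subtopology (Euclidean_space ?n) (\<phi> ` V)) (\<phi> ` K)"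
    unfolding im compactin_subtopology using BV by blast
  moreover have "K \<subseteq> topspace (top_of_set V)"
    unfolding K_def by auto
  ultimately have "compactin (top_of_set V) K"
    using homeomorphic_map_compactness[OF chart(3)] by blast
  then have "closed K"
    by (auto simp: compactin_subtopology intro: compact_imp_closed)
  \<comment> \<open>Differences are written as sums and products with constants, to match
    \<open>smooth_on_add\<close> and \<open>smooth_on_mult\<close>. Scaling to the value 1 at
    \<open>p\<close> comes last.\<close>
  define \<beta> where "\<beta> q = (if q \<in> V then \<Prod>i<?n. flat 0 (\<epsilon>\<^sup>2 + (-1) * ((\<phi> q i + - \<phi> p i) * (\<phi> q i + - \<phi> p i))) else 0)"
    for q
  have "smooth_on M V (\<lambda>q. flat 0 (\<epsilon>\<^sup>2 + (-1) * ((\<phi> q i + - \<phi> p i) * (\<phi> q i + - \<phi> p i))))"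
    if "i \<in> {..<?n}" for i
  proof -
    have "smooth_on M V (\<lambda>q. \<phi> q i)"
      using that by (intro smooth_on_chart_coordinate[OF M V(1)]) auto
    then have "smooth_on M V (\<lambda>q. \<phi> q i + - \<phi> p i)"
      by (rule smooth_on_add[OF M chart(1) _ smooth_on_const[OF M chart(1)]])
    from smooth_on_mult[OF M chart(1) this this] show ?thesis
      by (intro smooth_on_flat[OF M chart(1)] smooth_on_add[OF M chart(1) smooth_on_const[OF M chart(1)]]
          smooth_on_mult[OF M chart(1) smooth_on_const[OF M chart(1)]])
  qed
  then have "smooth_on M V (\<lambda>q. \<Prod>i<?n.
      flat 0 (\<epsilon>\<^sup>2 + (-1) * ((\<phi> q i + - \<phi> p i) * (\<phi> q i + - \<phi> p i))))"
    by (rule smooth_on_prod[OF M chart(1)])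
  then have "smooth_on M V \<beta>"
    by (rule smooth_on_cong[OF M chart(1)]) (simp add: \<beta>_def)
  have zero: "\<beta> q = 0" if "q \<notin> K" for q
  proof (cases "q \<in> V")
    case True
    \<comment> \<open>Coordinates from the dimension on vanish, so a point of the chart outside the
      box violates a bound in some earlier coordinate.\<close>
    have "\<phi> q \<in> topspace (Euclidean_space ?n)"
      using chart(2) True openin_subset by blast
    with that True obtain i where i: "i < ?n" "\<bar>\<phi> q i - \<phi> p i\<bar> > \<epsilon>"
      unfolding K_def B_def by (auto simp: topspace_Euclidean_space not_le)
    from i(2) \<epsilon> have "\<not> \<bar>\<phi> q i - \<phi> p i\<bar> \<le> \<bar>\<epsilon>\<bar>"
      by auto
    then have "\<epsilon>\<^sup>2 < (\<phi> q i - \<phi> p i)\<^sup>2"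
      by (simp only: abs_le_square_iff not_le)
    then have "flat 0 (\<epsilon>\<^sup>2 + (-1) * ((\<phi> q i + - \<phi> p i) * (\<phi> q i + - \<phi> p i))) = 0"
      by (simp add: flat_def power2_eq_square)
    with i(1) show ?thesis
      unfolding \<beta>_def by (auto intro!: prod_zero)
  qed (simp add: \<beta>_def)
  have "smooth_on M UNIV \<beta>"
    by (rule smooth_on_glue_zero[OF M chart(1) \<open>closed K\<close>])
      (use \<open>closed K\<close> \<open>smooth_on M V \<beta>\<close> zero in \<open>auto simp: K_def intro: smooth_on_const[OF M]\<close>)
  moreover have "\<beta> p > 0"
    unfolding \<beta>_def using V(2) \<epsilon> by (auto intro!: prod_pos simp: flat_def)
  ultimately have "smooth_on M UNIV (\<lambda>q. inverse (\<beta> p) * \<beta> q)" "inverse (\<beta> p) * \<beta> p = 1"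
    using smooth_on_mult[OF M open_UNIV smooth_on_const[OF M open_UNIV]] by auto
  with zero \<open>closed K\<close> \<open>K \<subseteq> W\<close> show thesis
    by (intro that[of "\<lambda>q. inverse (\<beta> p) * \<beta> q" K]) (auto simp: smooth_functions_def)
qed

section \<open>Sections of a vector bundle\<close>

lemma linear_form_on_add: "linear_form_on S \<alpha> \<Longrightarrow> x \<in> S \<Longrightarrow> y \<in> S \<Longrightarrow> \<alpha> (x + y) = \<alpha> x + \<alpha> y"
  and linear_form_on_scale: "linear_form_on S \<alpha> \<Longrightarrow> x \<in> S \<Longrightarrow> \<alpha> (c *\<^sub>R x) = c * \<alpha> x"
  unfolding linear_form_on_def by auto

lemma linear_form_on_zero: "linear_form_on S \<alpha> \<Longrightarrow> subspace S \<Longrightarrow> \<alpha> 0 = 0"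
  using linear_form_on_scale[of S \<alpha> 0 0] subspace_0 by fastforce

lemma linear_form_on_sum:
  assumes "linear_form_on S \<alpha>" and "subspace S" and "\<And>i. i \<in> I \<Longrightarrow> x i \<in> S"
  shows "\<alpha> (\<Sum>i\<in>I. c i *\<^sub>R x i) = (\<Sum>i\<in>I. c i * \<alpha> (x i))"
  using assms(3)
proof (induction I rule: infinite_finite_induct)
  case (insert i I)
  then show ?case
    using assms(1,2)
    by (simp add: linear_form_on_add linear_form_on_scale subspace_scale subspace_sum)
qed (use linear_form_on_zero[OF assms(1,2)] in auto)

lemma vector_bundleD:
  assumes "vector_bundle M E"
  shows vector_bundle_subspace: "subspace (fibre E p)"
    and vector_bundle_open: "(U, \<tau>) \<in> trivializations E \<Longrightarrow> open U"
    and vector_bundle_linear: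
      "(U, \<tau>) \<in> trivializations E \<Longrightarrow> q \<in> U \<Longrightarrow> linear_form_on (fibre E q) (\<lambda>x. \<tau> q x a)"
    and vector_bundle_bij: "(U, \<tau>) \<in> trivializations E \<Longrightarrow> q \<in> U \<Longrightarrow>
      bij_betw (\<tau> q) (fibre E q) {x. \<forall>i\<ge>bundle_rank E. x i = 0}"
proof -
  have "\<forall>p. subspace (fibre E p)"
    using assms unfolding vector_bundle_def by (elim conjE)
  then show "subspace (fibre E p)" ..
  have *: "\<forall>(U, \<tau>)\<in>trivializations E. open U \<and>
      (\<forall>p\<in>U. (\<forall>a. linear_form_on (fibre E p) (\<lambda>x. \<tau> p x a)) \<and>
        bij_betw (\<tau> p) (fibre E p) {x. \<forall>i\<ge>bundle_rank E. x i = 0})"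
    using assms unfolding vector_bundle_def topspace_Euclidean_space by (elim conjE)
  assume "(U, \<tau>) \<in> trivializations E"
  with * have U: "open U \<and> (\<forall>p\<in>U. (\<forall>a. linear_form_on (fibre E p) (\<lambda>x. \<tau> p x a)) \<and>
      bij_betw (\<tau> p) (fibre E p) {x. \<forall>i\<ge>bundle_rank E. x i = 0})"
    by auto
  then show "open U" ..
  assume "q \<in> U"
  with U show "linear_form_on (fibre E q) (\<lambda>x. \<tau> q x a)"
    and "bij_betw (\<tau> q) (fibre E q) {x. \<forall>i\<ge>bundle_rank E. x i = 0}"
    by auto
qed

lemma smooth_section_on_coordinate:
  "smooth_section_on M E W s \<Longrightarrow> (U, \<tau>) \<in> trivializations E \<Longrightarrow> a < bundle_rank E \<Longrightarrow>
    smooth_on M (U \<inter> W) (\<lambda>q. \<tau> q (s q) a)"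
  unfolding smooth_section_on_def by auto

lemma smooth_section_on_fibre: "smooth_section_on M E W s \<Longrightarrow> q \<in> W \<Longrightarrow> s q \<in> fibre E q"
  unfolding smooth_section_on_def by auto

lemma smooth_section_on_subset: "smooth_section_on M E W s \<Longrightarrow> W' \<subseteq> W \<Longrightarrow> smooth_section_on M E W' s"
  unfolding smooth_section_on_def[of M E W']
  by (auto intro: smooth_section_on_fibre smooth_on_subset[OF smooth_section_on_coordinate])

lemma smooth_section_on_add:
  assumes "smooth_manifold M" "vector_bundle M E" "open W"
    and "smooth_section_on M E W s" "smooth_section_on M E W t"
  shows "smooth_section_on M E W (\<lambda>q. s q + t q)"
  unfolding smooth_section_on_def
proof safe
  fix q assume "q \<in> W"
  then show "s q + t q \<in> fibre E q"
    using assms(4,5)[THEN smooth_section_on_fibre] vector_bundle_subspace[OF assms(2)]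
    by (auto intro: subspace_add)
next
  fix U \<tau> a assume U: "(U, \<tau>) \<in> trivializations E" and a: "a < bundle_rank E"
  have o: "open (U \<inter> W)"
    using vector_bundle_open[OF assms(2) U] assms(3) by auto
  have "smooth_on M (U \<inter> W) (\<lambda>q. \<tau> q (s q) a + \<tau> q (t q) a)"
    by (intro smooth_on_add[OF assms(1) o] smooth_section_on_coordinate[OF _ U a] assms(4,5))
  then show "smooth_on M (U \<inter> W) (\<lambda>q. \<tau> q (s q + t q) a)"
    by (rule smooth_on_cong[OF assms(1) o])
       (use assms(4,5)[THEN smooth_section_on_fibre] vector_bundle_linear[OF assms(2) U] in
         \<open>auto simp: linear_form_on_def\<close>)
qed

lemma smooth_section_on_scale:
  assumes "smooth_manifold M" "vector_bundle M E" "open W"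
    and "smooth_on M W f" "smooth_section_on M E W s"
  shows "smooth_section_on M E W (\<lambda>q. f q *\<^sub>R s q)"
  unfolding smooth_section_on_def
proof safe
  fix q assume "q \<in> W"
  then show "f q *\<^sub>R s q \<in> fibre E q"
    using assms(5)[THEN smooth_section_on_fibre] vector_bundle_subspace[OF assms(2)]
    by (auto intro: subspace_scale)
next
  fix U \<tau> a assume U: "(U, \<tau>) \<in> trivializations E" and a: "a < bundle_rank E"
  have o: "open (U \<inter> W)"
    using vector_bundle_open[OF assms(2) U] assms(3) by auto
  have "smooth_on M (U \<inter> W) (\<lambda>q. f q * \<tau> q (s q) a)"
    by (rule smooth_on_mult[OF assms(1) o smooth_on_subset[OF assms(4)]
        smooth_section_on_coordinate[OF assms(5) U a]]) auto
  then show "smooth_on M (U \<inter> W) (\<lambda>q. \<tau> q (f q *\<^sub>R s q) a)"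
    by (rule smooth_on_cong[OF assms(1) o])
       (use assms(5)[THEN smooth_section_on_fibre] vector_bundle_linear[OF assms(2) U] in
         \<open>auto simp: linear_form_on_def\<close>)
qed

lemma smooth_section_on_zero:
  assumes "smooth_manifold M" "vector_bundle M E" "open W"
  shows "smooth_section_on M E W (\<lambda>q. 0)"
  unfolding smooth_section_on_def
proof safe
  fix q show "0 \<in> fibre E q"
    using vector_bundle_subspace[OF assms(2)] by (rule subspace_0)
next
  fix U \<tau> a assume U: "(U, \<tau>) \<in> trivializations E" and a: "a < bundle_rank E"
  have o: "open (U \<inter> W)"
    using vector_bundle_open[OF assms(2) U] assms(3) by auto
  show "smooth_on M (U \<inter> W) (\<lambda>q. \<tau> q 0 a)"
    by (rule smooth_on_cong[OF assms(1) o smooth_on_const[OF assms(1) o, of 0]])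
       (use linear_form_on_zero[OF vector_bundle_linear[OF assms(2) U] vector_bundle_subspace[OF assms(2)]]
         in auto)
qed

lemma smooth_section_on_sum:
  assumes "smooth_manifold M" "vector_bundle M E" "open W"
    and "\<And>i. i \<in> I \<Longrightarrow> smooth_section_on M E W (s i)"
  shows "smooth_section_on M E W (\<lambda>q. \<Sum>i\<in>I. s i q)"
  using assms(4)
  by (induction I rule: infinite_finite_induct)
    (auto intro!: smooth_section_on_zero smooth_section_on_add assms(1-3))

text \<open>The bump kills \<open>f\<close> before the boundary of \<open>W\<close> is reached:
  \<open>W\<close> and the complement of \<open>K\<close> cover the manifold.\<close>

lemma cutoff_function:
  assumes M: "smooth_manifold M" and W: "open W" and f: "smooth_on M W f"
    and \<beta>: "\<beta> \<in> smooth_functions M" "closed K" "K \<subseteq> W" "\<And>q. q \<notin> K \<Longrightarrow> \<beta> q = 0"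
  shows "(\<lambda>q. if q \<in> W then \<beta> q * f q else 0) \<in> smooth_functions M"
proof -
  have "smooth_on M W (\<lambda>q. \<beta> q * f q)"
    using \<beta>(1) f by (auto simp: smooth_functions_def intro: smooth_on_mult[OF M W] smooth_on_subset)
  then have "smooth_on M W (\<lambda>q. if q \<in> W then \<beta> q * f q else 0)"
    by (rule smooth_on_cong[OF M W]) auto
  then show ?thesis
    unfolding smooth_functions_def using \<beta>
    by (auto intro!: smooth_on_glue_zero[OF M W, of K UNIV] smooth_on_const[OF M])
qed

text \<open>Smoothness is tested in each trivialization \<open>U\<close> separately, so the gluing
  takes place inside \<open>U\<close>, where the zero vector has zero coordinates by
  linearity.\<close>

lemma cutoff_section:
  assumes M: "smooth_manifold M" and E: "vector_bundle M E" and W: "open W"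
    and s: "smooth_section_on M E W s"
    and \<beta>: "\<beta> \<in> smooth_functions M" "closed K" "K \<subseteq> W" "\<And>q. q \<notin> K \<Longrightarrow> \<beta> q = 0"
  shows "(\<lambda>q. if q \<in> W then \<beta> q *\<^sub>R s q else 0) \<in> sections M E" (is "?t \<in> _")
proof -
  have *: "smooth_section_on M E W (\<lambda>q. \<beta> q *\<^sub>R s q)"
    using \<beta>(1) s
    by (auto simp: smooth_functions_def intro: smooth_section_on_scale[OF M E W] smooth_on_subset)
  show ?thesis
    unfolding sections_def smooth_section_on_def
  proof safe
    fix q show "?t q \<in> fibre E q"
      using smooth_section_on_fibre[OF *] vector_bundle_subspace[OF E] by (auto simp: subspace_0)
  next
    fix U \<tau> a assume U: "(U, \<tau>) \<in> trivializations E" and a: "a < bundle_rank E"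
    have o: "open U"
      using vector_bundle_open[OF E U] .
    have "smooth_on M (U \<inter> W) (\<lambda>q. \<tau> q (\<beta> q *\<^sub>R s q) a)"
      by (rule smooth_section_on_coordinate[OF * U a])
    then have "smooth_on M (U \<inter> W) (\<lambda>q. \<tau> q (?t q) a)"
      by (rule smooth_on_cong[OF M, rotated]) (use o W in auto)
    then have "smooth_on M U (\<lambda>q. \<tau> q (?t q) a)"
      using o \<beta> linear_form_on_zero[OF vector_bundle_linear[OF E U] vector_bundle_subspace[OF E]]
      by (intro smooth_on_glue_zero[OF M W, of K U] smooth_on_const[OF M]) auto
    then show "smooth_on M (U \<inter> UNIV) (\<lambda>q. \<tau> q (?t q) a)"
      by simp
  qed
qed

section \<open>Frames coming from trivializations\<close>

definition trivialization_frame ::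
    "('m, 'e :: real_vector) vbundle \<Rightarrow> ('m \<Rightarrow> 'e \<Rightarrow> nat \<Rightarrow> real) \<Rightarrow> nat \<Rightarrow> 'm \<Rightarrow> 'e" where
  "trivialization_frame E \<tau> b q = inv_into (fibre E q) (\<tau> q) (\<lambda>i. if i = b then 1 else 0)"

lemma trivialization_frame_props:
  assumes E: "vector_bundle M E" and U: "(U, \<tau>) \<in> trivializations E" "q \<in> U"
  shows "b < bundle_rank E \<Longrightarrow> trivialization_frame E \<tau> b q \<in> fibre E q"
    and "b < bundle_rank E \<Longrightarrow> \<tau> q (trivialization_frame E \<tau> b q) a = (if a = b then 1 else 0)"
    and "x \<in> fibre E q \<Longrightarrow> (\<Sum>b<bundle_rank E. \<tau> q x b *\<^sub>R trivialization_frame E \<tau> b q) = x"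
proof -
  note bij = vector_bundle_bij[OF E U]
  let ?X = "trivialization_frame E \<tau>"
  have mem: "?X b q \<in> fibre E q" and val: "\<tau> q (?X b q) a = (if a = b then 1 else 0)"
    if "b < bundle_rank E" for a b
  proof -
    have "(\<lambda>i. if i = b then 1 else 0) \<in> \<tau> q ` fibre E q"
      using bij_betw_imp_surj_on[OF bij] that by auto
    then show "?X b q \<in> fibre E q" "\<tau> q (?X b q) a = (if a = b then 1 else 0)"
      unfolding trivialization_frame_def by (auto simp: inv_into_into f_inv_into_f)
  qed
  show "b < bundle_rank E \<Longrightarrow> ?X b q \<in> fibre E q"
    "b < bundle_rank E \<Longrightarrow> \<tau> q (?X b q) a = (if a = b then 1 else 0)"
    using mem val by auto
  assume x: "x \<in> fibre E q"
  have "\<tau> q (\<Sum>b<bundle_rank E. \<tau> q x b *\<^sub>R ?X b q) a = \<tau> q x a" for a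
  proof -
    have "\<tau> q (\<Sum>b<bundle_rank E. \<tau> q x b *\<^sub>R ?X b q) a = (\<Sum>b<bundle_rank E. \<tau> q x b * \<tau> q (?X b q) a)"
      using mem by (intro linear_form_on_sum[OF vector_bundle_linear[OF E U] vector_bundle_subspace[OF E]]) auto
    also have "\<dots> = (\<Sum>b<bundle_rank E. if b = a then \<tau> q x b else 0)"
      using val by (intro sum.cong) auto
    \<comment> \<open>For \<open>a\<close> beyond the rank the sum is 0, and so is
      \<open>\<tau> q x a\<close>, because \<open>\<tau> q\<close> takes its values in
      r-space.\<close>
    also have "\<dots> = \<tau> q x a"
      using bij_betw_imp_surj_on[OF bij] x by (auto simp: not_less)
    finally show ?thesis .
  qed
  then have "\<tau> q (\<Sum>b<bundle_rank E. \<tau> q x b *\<^sub>R ?X b q) = \<tau> q x"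
    by blast
  then show "(\<Sum>b<bundle_rank E. \<tau> q x b *\<^sub>R ?X b q) = x"
    using bij_betw_imp_inj_on[OF bij] x mem vector_bundle_subspace[OF E]
    by (auto dest!: inj_onD intro!: subspace_sum subspace_scale)
qed

text \<open>The coordinates of this frame in another trivialization are the entries of the
  transition matrix, whose smoothness is part of \<open>vector_bundle\<close>.\<close>

lemma trivialization_frame_smooth:
  assumes "vector_bundle M E" and "(U, \<tau>) \<in> trivializations E" and "b < bundle_rank E"
  shows "smooth_section_on M E U (trivialization_frame E \<tau> b)"
proof -
  have "smooth_on M (V \<inter> U) (\<lambda>p. \<sigma> p (trivialization_frame E \<tau> b p) a)"
    if "(V, \<sigma>) \<in> trivializations E" "a < bundle_rank E" for V \<sigma> a
  proof -
    have "\<forall>(U, \<tau>)\<in>trivializations E. \<forall>(V, \<sigma>)\<in>trivializations E.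
        \<forall>a<bundle_rank E. \<forall>b<bundle_rank E. smooth_on M (U \<inter> V)
            (\<lambda>p. \<sigma> p (trivialization_frame E \<tau> b p) a)"
      using assms(1) unfolding vector_bundle_def trivialization_frame_def by (elim conjE)
    then have "smooth_on M (U \<inter> V) (\<lambda>p. \<sigma> p (trivialization_frame E \<tau> b p) a)"
      using assms(2,3) that by blast
    then show ?thesis by (simp add: Int_commute)
  qed
  then show ?thesis
    unfolding smooth_section_on_def using trivialization_frame_props(1)[OF assms(1,2)] assms(3) by auto
qed

lemma trivialization_frame_local_frame:
  assumes E: "vector_bundle M E" and U: "(U, \<tau>) \<in> trivializations E"
  shows "local_frame M E U (trivialization_frame E \<tau>)"
proof -
  let ?X = "trivialization_frame E \<tau>" and ?r = "bundle_rank E"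
  have "inj_on (\<lambda>a. ?X a q) {..<?r} \<and> independent ((\<lambda>a. ?X a q) ` {..<?r}) \<and>
      span ((\<lambda>a. ?X a q) ` {..<?r}) = fibre E q" if q: "q \<in> U" for q
  proof (intro conjI)
    note props = trivialization_frame_props[OF E U q]
    show inj: "inj_on (\<lambda>a. ?X a q) {..<?r}"
      by (rule inj_onI) (metis lessThan_iff props(2) zero_neq_one)
    show "independent ((\<lambda>a. ?X a q) ` {..<?r})"
    proof (rule ccontr)
      assume "\<not> independent ((\<lambda>a. ?X a q) ` {..<?r})"
      then obtain c b where b: "b < ?r" "c (?X b q) \<noteq> 0"
        and sum: "(\<Sum>v\<in>(\<lambda>a. ?X a q) ` {..<?r}. c v *\<^sub>R v) = 0"
        by (auto simp: dependent_finite)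
      \<comment> \<open>The b-th coordinate of the vanishing combination isolates the coefficient
        assumed nonzero.\<close>
      have "0 = \<tau> q (\<Sum>a<?r. c (?X a q) *\<^sub>R ?X a q) b"
        using sum linear_form_on_zero[OF vector_bundle_linear[OF E U q] vector_bundle_subspace[OF E]]
        by (simp add: sum.reindex[OF inj])
      also have "\<dots> = (\<Sum>a<?r. c (?X a q) * \<tau> q (?X a q) b)"
        using props(1)
        by (intro linear_form_on_sum[OF vector_bundle_linear[OF E U q] vector_bundle_subspace[OF E]]) auto
      also have "\<dots> = (\<Sum>a<?r. if a = b then c (?X a q) else 0)"
        using props(2) by (intro sum.cong) auto
      also have "\<dots> = c (?X b q)"
        using b(1) by simp
      finally show False using b(2) by simp
    qed
    show "span ((\<lambda>a. ?X a q) ` {..<?r}) = fibre E q"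
    proof
      show "span ((\<lambda>a. ?X a q) ` {..<?r}) \<subseteq> fibre E q"
        using props(1) vector_bundle_subspace[OF E] by (intro span_minimal) auto
      show "fibre E q \<subseteq> span ((\<lambda>a. ?X a q) ` {..<?r})"
        by (rule subsetI, subst props(3)[symmetric]) (auto intro: span_sum span_scale span_base)
    qed
  qed
  then show ?thesis
    unfolding local_frame_def
    using vector_bundle_open[OF E U] trivialization_frame_smooth[OF E U] by auto
qed

lemma trivialization_exists:
  assumes "vector_bundle M E"
  obtains U \<tau> where "(U, \<tau>) \<in> trivializations E" "p \<in> U"
proof -
  have "(\<Union>(U, \<tau>)\<in>trivializations E. U) = UNIV"
    using assms unfolding vector_bundle_def by (elim conjE)
  then have "p \<in> (\<Union>(U, \<tau>)\<in>trivializations E. U)"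
    by simp
  then show thesis
    using that by auto
qed

text \<open>Take the combination of frame vectors with constant coefficients and cut it off by a
  bump equal to 1 at \<open>p\<close>.\<close>

lemma section_through:
  assumes M: "smooth_manifold M" and E: "vector_bundle M E" and x: "x \<in> fibre E p"
  obtains s where "s \<in> sections M E" "s p = x"
proof -
  obtain U \<tau> where U: "(U, \<tau>) \<in> trivializations E" "p \<in> U"
    by (rule trivialization_exists[OF E])
  have o: "open U" using vector_bundle_open[OF E U(1)] .
  obtain \<beta> K where \<beta>: "\<beta> \<in> smooth_functions M" "\<beta> p = 1" "closed K" "K \<subseteq> U" "\<And>q. q \<notin> K \<Longrightarrow> \<beta> q = 0"
    using bump_function_exists[OF M o U(2)] by blast
  define s where "s = (\<lambda>q. \<Sum>b<bundle_rank E. \<tau> p x b *\<^sub>R trivialization_frame E \<tau> b q)"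
  have s: "smooth_section_on M E U s"
    unfolding s_def
    by (intro smooth_section_on_sum smooth_section_on_scale smooth_on_const
        trivialization_frame_smooth[OF E U(1)] M E o) auto
  show thesis
    by (rule that[OF cutoff_section[OF M E o s \<beta>(1,3,4,5)]])
      (use U(2) \<beta>(2) trivialization_frame_props(3)[OF E U x] in \<open>auto simp: s_def\<close>)
qed


section \<open>Pointwise values of a connection\<close>

lemma sections_scale:
  assumes "smooth_manifold M" "vector_bundle M E" "f \<in> smooth_functions M" "s \<in> sections M E"
  shows "(\<lambda>q. f q *\<^sub>R s q) \<in> sections M E"
  using smooth_section_on_scale[of M E UNIV f s] assms by (simp add: sections_def smooth_functions_def)

lemma sections_sum:
  assumes "smooth_manifold M" "vector_bundle M E" "\<And>i. i \<in> I \<Longrightarrow> s i \<in> sections M E"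
  shows "(\<lambda>q. \<Sum>i\<in>I. s i q) \<in> sections M E"
  using smooth_section_on_sum[of M E UNIV I s] assms by (simp add: sections_def)

lemma sections_fibre: "s \<in> sections M E \<Longrightarrow> s q \<in> fibre E q"
  using smooth_section_on_fibre[of M E UNIV s q] by (simp add: sections_def)

lemma real_bilinear_on_sectionsD:
  assumes "real_bilinear_on_sections M E B" "u \<in> sections M E" "v \<in> sections M E"
  shows "B u v \<in> sections M E"
    and "w \<in> sections M E \<Longrightarrow> B (\<lambda>q. u q + v q) w = (\<lambda>q. B u w q + B v w q)"
    and "B (\<lambda>q. c *\<^sub>R u q) v = (\<lambda>q. c *\<^sub>R B u v q)"
  using assms unfolding real_bilinear_on_sections_def by blast+

lemma real_bilinear_on_sections_sum_left:
  assumes M: "smooth_manifold M" and E: "vector_bundle M E" and B: "real_bilinear_on_sections M E B"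
    and "finite I" and s: "\<And>i. i \<in> I \<Longrightarrow> s i \<in> sections M E" and u: "u \<in> sections M E"
  shows "B (\<lambda>q. \<Sum>i\<in>I. s i q) u = (\<lambda>q. \<Sum>i\<in>I. B (s i) u q)"
  using assms(4) s
proof (induction I rule: finite_induct)
  case empty
  show ?case
    using real_bilinear_on_sectionsD(3)[OF B u u, of 0] by simp
next
  case (insert i I)
  then have "B (\<lambda>q. s i q + (\<Sum>i\<in>I. s i q)) u = (\<lambda>q. B (s i) u q + B (\<lambda>q. \<Sum>i\<in>I. s i q) u q)"
    by (intro real_bilinear_on_sectionsD(2)[OF B _ _ u] sections_sum[OF M E]) auto
  with insert show ?case by simp
qed

lemma connection_scale_left:
  assumes "linear_E_connection M E \<rho> nab" "f \<in> smooth_functions M" "s \<in> sections M E" "u \<in> sections M E"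
  shows "nab (\<lambda>q. f q *\<^sub>R s q) u = (\<lambda>q. f q *\<^sub>R nab s u q)"
  using assms unfolding linear_E_connection_def by blast

text \<open>With a bump function \<open>\<beta>\<close> supported in a trivialization and \<open>w = \<Sum>\<^sub>b w\<^sub>b X\<^sub>b\<close> there, the global
  identity \<open>\<beta>\<^sup>2 w = \<Sum>\<^sub>b (\<beta> w\<^sub>b) (\<beta> X\<^sub>b)\<close> reduces the claim to linearity over smooth functions.\<close>

lemma connection_vanishes_pointwise:
  assumes M: "smooth_manifold M" and E: "vector_bundle M E"
    and nab: "linear_E_connection M E \<rho> nab"
    and w: "w \<in> sections M E" and u: "u \<in> sections M E" and "w p = 0"
  shows "nab w u p = 0"
proof -
  have bil: "real_bilinear_on_sections M E nab"
    using nab by (simp add: linear_E_connection_def)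
  obtain U \<tau> where U: "(U, \<tau>) \<in> trivializations E" "p \<in> U"
    by (rule trivialization_exists[OF E])
  have o: "open U" using vector_bundle_open[OF E U(1)] .
  obtain \<beta> K where \<beta>: "\<beta> \<in> smooth_functions M" "\<beta> p = 1" "closed K" "K \<subseteq> U" "\<And>q. q \<notin> K \<Longrightarrow> \<beta> q = 0"
    using bump_function_exists[OF M o U(2)] by blast
  let ?X = "trivialization_frame E \<tau>" and ?r = "bundle_rank E"
  \<comment> \<open>Neither the coordinates of \<open>w\<close> nor the frame is controlled off
    \<open>U\<close>. Each absorbs one factor \<open>\<beta>\<close>, hence the square.\<close>
  define c where "c b = (\<lambda>q. if q \<in> U then \<beta> q * \<tau> q (w q) b else 0)" for b
  define Y where "Y b = (\<lambda>q. if q \<in> U then \<beta> q *\<^sub>R ?X b q else 0)" for b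
  have c: "c b \<in> smooth_functions M" and Y: "Y b \<in> sections M E" if "b < ?r" for b
  proof -
    have "smooth_on M U (\<lambda>q. \<tau> q (w q) b)"
      using smooth_section_on_coordinate[of M E UNIV w, OF _ U(1) that] w by (simp add: sections_def)
    from cutoff_function[OF M o this \<beta>(1,3,4,5)] show "c b \<in> smooth_functions M"
      unfolding c_def .
    from cutoff_section[OF M E o trivialization_frame_smooth[OF E U(1) that] \<beta>(1,3,4,5)]
    show "Y b \<in> sections M E"
      unfolding Y_def .
  qed
  have "(\<beta> q * \<beta> q) *\<^sub>R w q = (\<Sum>b<?r. c b q *\<^sub>R Y b q)" for q
  proof (cases "q \<in> U")
    case True
    have "(\<beta> q * \<beta> q) *\<^sub>R w q = (\<beta> q * \<beta> q) *\<^sub>R (\<Sum>b<?r. \<tau> q (w q) b *\<^sub>R ?X b q)"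
      using trivialization_frame_props(3)[OF E U(1) True sections_fibre[OF w]] by simp
    also have "\<dots> = (\<Sum>b<?r. c b q *\<^sub>R Y b q)"
      using True by (simp add: c_def Y_def scaleR_sum_right mult_ac)
    finally show ?thesis .
  next
    case False
    then have "\<beta> q = 0" using \<beta>(4,5) by blast
    with False show ?thesis by (simp add: c_def)
  qed
  then have "nab (\<lambda>q. (\<beta> q * \<beta> q) *\<^sub>R w q) u p = nab (\<lambda>q. \<Sum>b<?r. c b q *\<^sub>R Y b q) u p"
    by simp
  also have "\<dots> = (\<Sum>b<?r. nab (\<lambda>q. c b q *\<^sub>R Y b q) u p)"
    using c Y by (subst real_bilinear_on_sections_sum_left[OF M E bil _ _ u]) (auto intro: sections_scale[OF M E])
  also have "\<dots> = (\<Sum>b<?r. c b p *\<^sub>R nab (Y b) u p)"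
    using c Y by (intro sum.cong refl) (simp add: connection_scale_left[OF nab _ _ u])
  also have "\<dots> = 0"
    using \<open>w p = 0\<close> U(2) linear_form_on_zero[OF vector_bundle_linear[OF E U] vector_bundle_subspace[OF E]]
    by (simp add: c_def)
  finally have "nab (\<lambda>q. (\<beta> q * \<beta> q) *\<^sub>R w q) u p = 0" .
  \<comment> \<open>Pulling the square of \<open>\<beta>\<close> out of the first argument changes
    nothing at \<open>p\<close>, where it is 1.\<close>
  moreover have "(\<lambda>q. \<beta> q * \<beta> q) \<in> smooth_functions M"
    using smooth_on_mult[OF M open_UNIV] \<beta>(1) by (simp add: smooth_functions_def)
  ultimately show ?thesis
    using connection_scale_left[OF nab _ w u] \<beta>(2) by simp
qed

lemma connection_pointwise:
  assumes M: "smooth_manifold M" and E: "vector_bundle M E" and nab: "linear_E_connection M E \<rho> nab"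
    and w: "w \<in> sections M E" and w': "w' \<in> sections M E" and u: "u \<in> sections M E" and eq: "w p = w' p"
  shows "nab w u p = nab w' u p"
proof -
  have bil: "real_bilinear_on_sections M E nab"
    using nab by (simp add: linear_E_connection_def)
  \<comment> \<open>The difference of the two sections is a sum with a real multiple, the form
    covered by bilinearity.\<close>
  define m where "m = (\<lambda>q. (-1) *\<^sub>R w' q)"
  have const: "(\<lambda>q. -1) \<in> smooth_functions M"
    using smooth_on_const[OF M open_UNIV] by (simp add: smooth_functions_def)
  have m: "m \<in> sections M E"
    unfolding m_def by (rule sections_scale[OF M E const w'])
  have "(\<lambda>q. w q + m q) \<in> sections M E"
    using smooth_section_on_add[OF M E open_UNIV] w m by (simp add: sections_def)
  then have "nab (\<lambda>q. w q + m q) u p = 0"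
    by (rule connection_vanishes_pointwise[OF M E nab _ u]) (simp add: m_def eq)
  moreover have "nab m u p = - nab w' u p"
    unfolding m_def using real_bilinear_on_sectionsD(3)[OF bil w' u, of "-1"] by simp
  ultimately show ?thesis
    using real_bilinear_on_sectionsD(2)[OF bil w m u] by simp
qed

text \<open>All sections with the same value at \<open>p\<close> give the same result by
  \<open>connection_pointwise\<close>, so the description in \<open>connection_at\<close> has a
  unique solution.\<close>

lemma connection_at_section:
  assumes "smooth_manifold M" "vector_bundle M E" "linear_E_connection M E \<rho> nab"
    and "w \<in> sections M E" "u \<in> sections M E"
  shows "connection_at M E nab p (w p) u = nab w u p"
  unfolding connection_at_def
proof (rule the_equality)
  show "\<exists>w'\<in>sections M E. w' p = w p \<and> nab w u p = nab w' u p"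
    using assms(4) by blast
next
  fix z assume "\<exists>w'\<in>sections M E. w' p = w p \<and> z = nab w' u p"
  then show "z = nab w u p"
    using connection_pointwise[OF assms(1-3) _ assms(4,5)] by blast
qed

lemma connection_at_fibre:
  assumes M: "smooth_manifold M" and E: "vector_bundle M E" and nab: "linear_E_connection M E \<rho> nab"
    and x: "x \<in> fibre E p" and u: "u \<in> sections M E"
  shows "connection_at M E nab p x u \<in> fibre E p"
proof -
  obtain s where s: "s \<in> sections M E" "s p = x"
    by (rule section_through[OF M E x])
  have "nab s u \<in> sections M E"
    using nab real_bilinear_on_sectionsD(1) s(1) u unfolding linear_E_connection_def by blast
  then show ?thesis
    using connection_at_section[OF M E nab s(1) u, of p] s(2) sections_fibre by metis
qed

text \<open>Extend each vector to a global section; constant coefficients then come out by real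
  linearity of \<open>nab\<close>.\<close>

lemma connection_at_sum:
  assumes M: "smooth_manifold M" and E: "vector_bundle M E" and nab: "linear_E_connection M E \<rho> nab"
    and "finite I" and x: "\<And>i. i \<in> I \<Longrightarrow> x i \<in> fibre E p" and u: "u \<in> sections M E"
  shows "connection_at M E nab p (\<Sum>i\<in>I. c i *\<^sub>R x i) u = (\<Sum>i\<in>I. c i *\<^sub>R connection_at M E nab p (x i) u)"
proof -
  have bil: "real_bilinear_on_sections M E nab"
    using nab by (simp add: linear_E_connection_def)
  have "\<forall>i\<in>I. \<exists>s. s \<in> sections M E \<and> s p = x i"
    using section_through[OF M E x] by metis
  then obtain s where s: "\<And>i. i \<in> I \<Longrightarrow> s i \<in> sections M E" "\<And>i. i \<in> I \<Longrightarrow> s i p = x i"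
    by metis
  have const: "(\<lambda>q. d) \<in> smooth_functions M" for d
    using smooth_on_const[OF M open_UNIV] by (simp add: smooth_functions_def)
  have cs: "(\<lambda>q. c i *\<^sub>R s i q) \<in> sections M E" if "i \<in> I" for i
    using that s(1) by (intro sections_scale[OF M E const])
  have "(\<Sum>i\<in>I. c i *\<^sub>R x i) = (\<lambda>q. \<Sum>i\<in>I. c i *\<^sub>R s i q) p"
    using s(2) by simp
  then have "connection_at M E nab p (\<Sum>i\<in>I. c i *\<^sub>R x i) u = nab (\<lambda>q. \<Sum>i\<in>I. c i *\<^sub>R s i q) u p"
    using connection_at_section[OF M E nab sections_sum[OF M E cs] u] by simp
  also have "\<dots> = (\<Sum>i\<in>I. nab (\<lambda>q. c i *\<^sub>R s i q) u p)"
    using real_bilinear_on_sections_sum_left[OF M E bil \<open>finite I\<close> cs u] by simp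
  also have "\<dots> = (\<Sum>i\<in>I. c i *\<^sub>R nab (s i) u p)"
    using s(1) real_bilinear_on_sectionsD(3)[OF bil _ u] by (intro sum.cong refl) simp
  also have "\<dots> = (\<Sum>i\<in>I. c i *\<^sub>R connection_at M E nab p (x i) u)"
    using s connection_at_section[OF M E nab s(1) u, of _ p] by (intro sum.cong refl) auto
  finally show ?thesis .
qed

section \<open>Metrics and one-forms\<close>

text \<open>The Gram map \<open>T\<close>, sending \<open>x\<close> to the sum of
  \<open>g x a *\<^sub>R a\<close> over the basis, is injective on the span by non-degeneracy, hence
  onto by a dimension count. A preimage of the vector with coordinates \<open>\<alpha> a\<close>
  represents \<open>\<alpha>\<close>. As \<open>'e\<close> may be infinite-dimensional, the count is
  made with independent sets inside \<open>span B\<close>.\<close>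

lemma nondegenerate_form_represents:
  fixes g :: "'e :: real_vector \<Rightarrow> 'e \<Rightarrow> real"
  assumes B: "finite B" "independent B"
    and lin: "\<And>x. x \<in> span B \<Longrightarrow> linear_form_on (span B) (g x)"
    and sym: "\<And>x y. x \<in> span B \<Longrightarrow> y \<in> span B \<Longrightarrow> g x y = g y x"
    and nondeg: "\<And>x. x \<in> span B \<Longrightarrow> (\<And>y. y \<in> span B \<Longrightarrow> g x y = 0) \<Longrightarrow> x = 0"
    and \<alpha>: "linear_form_on (span B) \<alpha>"
  shows "\<exists>x\<in>span B. \<forall>y\<in>span B. g x y = \<alpha> y"
proof -
  have eq: "\<gamma> y = (\<Sum>b\<in>B. representation B y b * \<gamma> b)"
    if "linear_form_on (span B) \<gamma>" "y \<in> span B" for \<gamma> y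
    using linear_form_on_sum[OF that(1) subspace_span, of B "\<lambda>b. b" "representation B y"]
      sum_representation_eq[OF B(2) that(2) B(1)] by (simp add: span_base)
  obtain T where T: "linear T" "\<And>b. b \<in> B \<Longrightarrow> T b = (\<Sum>a\<in>B. g b a *\<^sub>R a)"
    using linear_independent_extend[OF B(2), of "\<lambda>b. \<Sum>a\<in>B. g b a *\<^sub>R a"] by blast
  have Tx: "T x = (\<Sum>a\<in>B. g x a *\<^sub>R a)" if x: "x \<in> span B" for x
  proof -
    have "T x = T (\<Sum>b\<in>B. representation B x b *\<^sub>R b)"
      using sum_representation_eq[OF B(2) x B(1)] by simp
    also have "\<dots> = (\<Sum>b\<in>B. representation B x b *\<^sub>R (\<Sum>a\<in>B. g b a *\<^sub>R a))"
      using T by (simp add: linear_sum linear_scale)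
    also have "\<dots> = (\<Sum>a\<in>B. (\<Sum>b\<in>B. representation B x b * g b a) *\<^sub>R a)"
      by (simp add: scaleR_sum_right scaleR_sum_left) (rule sum.swap)
    also have "\<dots> = (\<Sum>a\<in>B. g x a *\<^sub>R a)"
    proof (intro sum.cong refl)
      fix a assume a: "a \<in> B"
      \<comment> \<open>Linearity is assumed in the second slot only; symmetry brings
        \<open>x\<close> there to be expanded and then restores the order.\<close>
      have "g x a = g a x"
        using sym a x by (simp add: span_base)
      also have "\<dots> = (\<Sum>b\<in>B. representation B x b * g a b)"
        using eq[OF lin x] a by (simp add: span_base)
      also have "\<dots> = (\<Sum>b\<in>B. representation B x b * g b a)"
        using sym a by (intro sum.cong refl) (simp add: span_base)
      finally show "(\<Sum>b\<in>B. representation B x b * g b a) *\<^sub>R a = g x a *\<^sub>R a"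
        by simp
    qed
    finally show ?thesis .
  qed
  have coeff: "c b = d b" if "(\<Sum>a\<in>B. c a *\<^sub>R a) = (\<Sum>a\<in>B. d a *\<^sub>R a)" "b \<in> B" for c d :: "'e \<Rightarrow> real" and b
  proof -
    have "(\<Sum>a\<in>B. (c a - d a) *\<^sub>R a) = 0"
      using that(1) by (simp add: scaleR_left_diff_distrib sum_subtractf)
    then show ?thesis
      using independentD[OF B(2) B(1) order_refl _ that(2), of "\<lambda>a. c a - d a"] by simp
  qed
  have inj: "inj_on T (span B)"
  proof (rule linear_inj_on_iff_eq_0[OF T(1) subspace_span, THEN iffD2, rule_format])
    fix x assume x: "x \<in> span B" "T x = 0"
    then have "g x a = 0" if "a \<in> B" for a
      using coeff[of "g x" "\<lambda>_. 0", OF _ that] Tx by simp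
    then show "x = 0"
      using eq[OF lin[OF x(1)]] by (intro nondeg x(1)) simp
  qed
  have indep: "independent (T ` B)"
    using T(1) B(2) inj by (rule linear_independent_injective_image)
  have card: "card (T ` B) = card B"
    using inj by (intro card_image) (rule inj_on_subset, auto simp: span_base)
  have sub: "T ` B \<subseteq> span B"
    using T(2) by (auto intro: span_sum span_scale span_base)
  define z where "z = (\<Sum>a\<in>B. \<alpha> a *\<^sub>R a)"
  have z: "z \<in> span B"
    unfolding z_def by (auto intro: span_sum span_scale span_base)
  \<comment> \<open>Otherwise \<open>z\<close> and the images of the basis would be
    \<open>card B + 1\<close> independent vectors in \<open>span B\<close>.\<close>
  have "z \<in> span (T ` B)"
  proof (rule ccontr)
    assume nz: "z \<notin> span (T ` B)"
    then have "independent (insert z (T ` B))" "z \<notin> T ` B"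
      using indep by (auto simp: independent_insert span_base)
    then have "card (insert z (T ` B)) \<le> card B"
      using independent_span_bound[OF B(1)] sub z by blast
    then show False
      using card B(1) \<open>z \<notin> T ` B\<close> by simp
  qed
  then obtain x where x: "x \<in> span B" "z = T x"
    using linear_span_image[OF T(1), of B] by auto
  then have "g x a = \<alpha> a" if "a \<in> B" for a
    using coeff[of "g x" \<alpha>, OF _ that] Tx by (simp add: z_def)
  then have "g x y = \<alpha> y" if "y \<in> span B" for y
    using eq[OF lin[OF x(1)] that] eq[OF \<alpha> that] by simp
  with x(1) show ?thesis by blast
qed


lemma E_metricD:
  assumes "E_metric M E g" and "x \<in> fibre E p"
  shows "linear_form_on (fibre E p) (g p x)"
    and "y \<in> fibre E p \<Longrightarrow> g p x y = g p y x"
    and "(\<And>y. y \<in> fibre E p \<Longrightarrow> g p x y = 0) \<Longrightarrow> x = 0"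
proof -
  have 1: "\<forall>p. \<forall>x\<in>fibre E p. linear_form_on (fibre E p) (g p x)"
    and 2: "\<forall>p. \<forall>x\<in>fibre E p. \<forall>y\<in>fibre E p. g p x y = g p y x"
    and 3: "\<forall>p. \<forall>x\<in>fibre E p. (\<forall>y\<in>fibre E p. g p x y = 0) \<longrightarrow> x = 0"
    using assms(1) by (simp_all add: E_metric_def)
  show "linear_form_on (fibre E p) (g p x)" "y \<in> fibre E p \<Longrightarrow> g p x y = g p y x"
    using 1 2 assms(2) by auto
  show "x = 0" if "\<And>y. y \<in> fibre E p \<Longrightarrow> g p x y = 0"
    using 3 assms(2) that by blast
qed

lemma E_metric_sum_left:
  assumes g: "E_metric M E g" and E: "vector_bundle M E"
    and x: "\<And>i. i \<in> I \<Longrightarrow> x i \<in> fibre E p" and y: "y \<in> fibre E p"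
  shows "g p (\<Sum>i\<in>I. c i *\<^sub>R x i) y = (\<Sum>i\<in>I. c i * g p (x i) y)"
proof -
  note F = vector_bundle_subspace[OF E, of p]
  have "g p (\<Sum>i\<in>I. c i *\<^sub>R x i) y = g p y (\<Sum>i\<in>I. c i *\<^sub>R x i)"
    using x y by (intro E_metricD(2)[OF g] subspace_sum[OF F] subspace_scale[OF F])
  also have "\<dots> = (\<Sum>i\<in>I. c i * g p y (x i))"
    using x by (rule linear_form_on_sum[OF E_metricD(1)[OF g y] F])
  also have "\<dots> = (\<Sum>i\<in>I. c i * g p (x i) y)"
    using x y E_metricD(2)[OF g y] by (intro sum.cong refl) simp
  finally show ?thesis .
qed

lemma E_metric_eqI:
  assumes g: "E_metric M E g" and E: "vector_bundle M E"
    and x: "x \<in> fibre E p" and x': "x' \<in> fibre E p"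
    and eq: "\<And>y. y \<in> fibre E p \<Longrightarrow> g p x y = g p x' y"
  shows "x = x'"
proof -
  note F = vector_bundle_subspace[OF E, of p]
  have "g p (x - x') y = 0" if y: "y \<in> fibre E p" for y
  proof -
    have "g p (x - x') y = g p y (x + (-1) *\<^sub>R x')"
      using E_metricD(2)[OF g subspace_diff[OF F x x'] y] by simp
    also have "\<dots> = g p y x - g p y x'"
      using E_metricD(1)[OF g y] x x'
      by (simp only: linear_form_on_add linear_form_on_scale subspace_scale[OF F])
    also have "\<dots> = 0"
      using eq[OF y] E_metricD(2)[OF g y] x x' by simp
    finally show ?thesis .
  qed
  then show ?thesis
    using E_metricD(3)[OF g subspace_diff[OF F x x']] by simp
qed

lemma local_frame_exists:
  assumes "vector_bundle M E"
  obtains U X where "local_frame M E U X" "p \<in> U"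
  using trivialization_exists[OF assms] trivialization_frame_local_frame[OF assms] by metis

text \<open>Existence is the representation lemma for the finite basis that a local frame provides
  at \<open>p\<close>; uniqueness is non-degeneracy.\<close>

lemma metric_inverse_props:
  assumes g: "E_metric M E g" and E: "vector_bundle M E" and \<alpha>: "linear_form_on (fibre E p) \<alpha>"
  shows "metric_inverse E g p \<alpha> \<in> fibre E p"
    and "y \<in> fibre E p \<Longrightarrow> g p (metric_inverse E g p \<alpha>) y = \<alpha> y"
proof -
  obtain U X where X: "local_frame M E U X" "p \<in> U"
    by (rule local_frame_exists[OF E])
  define B where "B = (\<lambda>a. X a p) ` {..<bundle_rank E}"
  have B: "finite B" "independent B" "span B = fibre E p"
    using X unfolding local_frame_def B_def by auto
  have "\<exists>x\<in>fibre E p. \<forall>y\<in>fibre E p. g p x y = \<alpha> y"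
    unfolding B(3)[symmetric]
    by (rule nondegenerate_form_represents[OF B(1,2)]) (use E_metricD[OF g] \<alpha> B(3) in auto)
  then have "\<exists>!x. x \<in> fibre E p \<and> (\<forall>y\<in>fibre E p. g p x y = \<alpha> y)"
    using E_metric_eqI[OF g E] by (metis (no_types, lifting))
  from theI'[OF this]
  show "metric_inverse E g p \<alpha> \<in> fibre E p"
    and "y \<in> fibre E p \<Longrightarrow> g p (metric_inverse E g p \<alpha>) y = \<alpha> y"
    unfolding metric_inverse_def by auto
qed

text \<open>Every covector has the form \<open>g(x, \<cdot>)\<close>, so that a section through \<open>x\<close> gives the one-form.\<close>

lemma one_form_through:
  assumes M: "smooth_manifold M" and E: "vector_bundle M E" and g: "E_metric M E g"
    and \<alpha>: "\<alpha> \<in> dual_fibre E p"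
  obtains \<Omega> where "\<Omega> \<in> one_forms M E" "\<Omega> p = \<alpha>"
proof -
  have lin: "linear_form_on (fibre E p) \<alpha>" and out: "\<And>x. x \<notin> fibre E p \<Longrightarrow> \<alpha> x = 0"
    using \<alpha> by (auto simp: dual_fibre_def)
  note inv = metric_inverse_props[OF g E lin]
  obtain s where s: "s \<in> sections M E" "s p = metric_inverse E g p \<alpha>"
    by (rule section_through[OF M E inv(1)])
  define \<Omega> where "\<Omega> = (\<lambda>q y. if y \<in> fibre E q then g q (s q) y else 0)"
  have "\<Omega> q \<in> dual_fibre E q" for q
    using E_metricD(1)[OF g sections_fibre[OF s(1)], of q] vector_bundle_subspace[OF E, of q]
    unfolding dual_fibre_def linear_form_on_def \<Omega>_def by (auto simp: subspace_add subspace_scale)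
  moreover have "smooth_on M W (\<lambda>q. \<Omega> q (t q))" if W: "open W" "smooth_section_on M E W t" for W t
  proof -
    have "smooth_section_on M E W s"
      using s(1) smooth_section_on_subset[of M E UNIV s W] by (simp add: sections_def)
    then have "smooth_on M W (\<lambda>q. g q (s q) (t q))"
      using g W unfolding E_metric_def by blast
    then show ?thesis
      by (rule smooth_on_cong[OF M W(1)]) (use smooth_section_on_fibre[OF W(2)] in \<open>auto simp: \<Omega>_def\<close>)
  qed
  ultimately have "\<Omega> \<in> one_forms M E"
    unfolding one_forms_def by blast
  moreover have "\<Omega> p = \<alpha>"
    using inv(2) out s(2) by (auto simp: \<Omega>_def fun_eq_iff)
  ultimately show thesis
    by (rule that)
qed

text \<open>The operator is given by a pointwise formula, so all representatives give the same
  value. What has to be supplied is one global representative for each argument.\<close>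

lemma locality_at_metric:
  assumes M: "smooth_manifold M" and E: "vector_bundle M E" and g: "E_metric M E g"
    and \<alpha>: "\<alpha> \<in> dual_fibre E p" and x: "x \<in> fibre E p" and y: "y \<in> fibre E p"
  shows "locality_at M E (metric_locality_operator E g) p \<alpha> x y = g p x y *\<^sub>R metric_inverse E g p \<alpha>"
proof -
  obtain \<Omega> where "\<Omega> \<in> one_forms M E" "\<Omega> p = \<alpha>"
    by (rule one_form_through[OF M E g \<alpha>])
  moreover obtain u where "u \<in> sections M E" "u p = x"
    by (rule section_through[OF M E x])
  moreover obtain v where "v \<in> sections M E" "v p = y"
    by (rule section_through[OF M E y])
  ultimately show ?thesis
    unfolding locality_at_def metric_locality_operator_def by (intro the_equality) auto
qed

section \<open>Admissibility\<close>

lemma dual_coframe_props: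
  assumes X: "local_frame M E U X" and p: "p \<in> U"
  shows "dual_coframe E X a p \<in> dual_fibre E p"
    and "x \<in> fibre E p \<Longrightarrow> (\<Sum>a<bundle_rank E. dual_coframe E X a p x *\<^sub>R X a p) = x"
    and "a < bundle_rank E \<Longrightarrow> X a p \<in> fibre E p"
proof -
  define B where "B = (\<lambda>a. X a p) ` {..<bundle_rank E}"
  have B: "finite B" "independent B" "span B = fibre E p"
    and inj: "inj_on (\<lambda>a. X a p) {..<bundle_rank E}"
    using X p unfolding local_frame_def B_def by auto
  have dual: "dual_coframe E X a p x = representation B x (X a p)" for a x
    by (simp add: dual_coframe_def B_def)
  \<comment> \<open>The default value of \<open>representation\<close> off the span matches the
    convention that covectors vanish off the fibre.\<close>
  have "representation B x = (\<lambda>_. 0)" if "x \<notin> fibre E p" for x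
    using that B(3) by (simp add: representation_def)
  then show "dual_coframe E X a p \<in> dual_fibre E p"
    using B representation_add[OF B(2)] representation_scale[OF B(2)]
    unfolding dual_fibre_def linear_form_on_def dual by simp
  show "(\<Sum>a<bundle_rank E. dual_coframe E X a p x *\<^sub>R X a p) = x" if "x \<in> fibre E p"
  proof -
    have "(\<Sum>b\<in>B. representation B x b *\<^sub>R b) = x"
      using sum_representation_eq[OF B(2) _ B(1) order_refl] that B(3) by auto
    then show ?thesis
      unfolding dual unfolding B_def sum.reindex[OF inj] by simp
  qed
  show "X a p \<in> fibre E p" if "a < bundle_rank E"
    using that B(3) span_base[of "X a p" B] by (auto simp: B_def)
qed

text \<open>Pairing with \<open>y\<close> turns \<open>\<Sum>\<^sub>a g(\<nabla>\<^sub>X\<^sub>a u, v) g\<inverse>(e\<^sup>a)\<close> into \<open>g(\<nabla>\<^sub>y u, v)\<close>.\<close>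

lemma metric_locality_frame_sum:
  assumes M: "smooth_manifold M" and E: "vector_bundle M E" and g: "E_metric M E g"
    and nab: "linear_E_connection M E \<rho> nab"
    and X: "local_frame M E U X" and p: "p \<in> U"
    and u: "u \<in> sections M E" and x: "x \<in> fibre E p"
  defines "z \<equiv> \<Sum>a<bundle_rank E. locality_at M E (metric_locality_operator E g) p (dual_coframe E X a p)
      (connection_at M E nab p (X a p) u) x"
  shows "z \<in> fibre E p"
    and "y \<in> fibre E p \<Longrightarrow> g p z y = g p (connection_at M E nab p y u) x"
proof -
  note F = vector_bundle_subspace[OF E, of p]
  note dual = dual_coframe_props[OF X p]
  let ?e = "\<lambda>a. dual_coframe E X a p" and ?c = "\<lambda>a. connection_at M E nab p (X a p) u"
  have c: "?c a \<in> fibre E p" if "a \<in> {..<bundle_rank E}" for a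
    using connection_at_fibre[OF M E nab _ u] dual(3) that by auto
  have inv: "metric_inverse E g p (?e a) \<in> fibre E p"
    "y \<in> fibre E p \<Longrightarrow> g p (metric_inverse E g p (?e a)) y = ?e a y" for a y
    using metric_inverse_props[OF g E] dual(1) by (auto simp: dual_fibre_def)
  have z: "z = (\<Sum>a<bundle_rank E. g p (?c a) x *\<^sub>R metric_inverse E g p (?e a))"
    unfolding z_def using c x by (intro sum.cong refl locality_at_metric[OF M E g dual(1)])
  show "z \<in> fibre E p"
    unfolding z using inv(1) by (intro subspace_sum[OF F] subspace_scale[OF F])
  assume y: "y \<in> fibre E p"
  have "g p z y = (\<Sum>a<bundle_rank E. g p (?c a) x * g p (metric_inverse E g p (?e a)) y)"
    unfolding z using inv(1) y by (intro E_metric_sum_left[OF g E])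
  also have "\<dots> = (\<Sum>a<bundle_rank E. ?e a y * g p (?c a) x)"
    using inv(2)[OF y] by (simp add: mult.commute)
  also have "\<dots> = g p (\<Sum>a<bundle_rank E. ?e a y *\<^sub>R ?c a) x"
    using c x by (intro E_metric_sum_left[OF g E, symmetric])
  also have "(\<Sum>a<bundle_rank E. ?e a y *\<^sub>R ?c a) =
      connection_at M E nab p (\<Sum>a<bundle_rank E. ?e a y *\<^sub>R X a p) u"
    using dual(3) by (intro connection_at_sum[OF M E nab _ _ u, symmetric]) auto
  also have "(\<Sum>a<bundle_rank E. ?e a y *\<^sub>R X a p) = y"
    using y by (rule dual(2))
  finally show "g p z y = g p (connection_at M E nab p y u) x" .
qed

theorem proposition3p5:
  fixes M :: "('m :: {t2_space, second_countable_topology}) smooth_structure"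
    and E :: "('m, 'e :: real_vector) vbundle"
    and \<rho> :: "'m \<Rightarrow> 'e \<Rightarrow> ('m \<Rightarrow> real) \<Rightarrow> real"
    and br :: "('m \<Rightarrow> 'e) \<Rightarrow> ('m \<Rightarrow> 'e) \<Rightarrow> 'm \<Rightarrow> 'e"
    and g :: "'m \<Rightarrow> 'e \<Rightarrow> 'e \<Rightarrow> real"
    and nab :: "('m \<Rightarrow> 'e) \<Rightarrow> ('m \<Rightarrow> 'e) \<Rightarrow> 'm \<Rightarrow> 'e"
  assumes "almost_Courant_algebroid M E \<rho> br g"
    and "linear_E_connection M E \<rho> nab"
  shows "admissible M E br (metric_locality_operator E g) nab \<longleftrightarrow> metric_compatible M E \<rho> g nab"
proof -
  note nab = assms(2)
  have anchored: "anchored_vector_bundle M E \<rho>" and g: "E_metric M E g"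
    and courant: "\<forall>u\<in>sections M E. \<forall>v\<in>sections M E. (\<lambda>p. br u v p + br v u p) =
        (\<lambda>p. metric_inverse E g p (E_differential E \<rho> (\<lambda>q. g q (u q) (v q)) p))"
    using assms(1) unfolding almost_Courant_algebroid_def almost_Leibniz_algebroid_def by auto
  have M: "smooth_manifold M" and E: "vector_bundle M E"
    and \<rho>: "\<forall>p f. linear_form_on (fibre E p) (\<lambda>x. \<rho> p x f)"
    using anchored by (simp_all add: anchored_vector_bundle_def)
  let ?R = "\<lambda>X p u v. \<Sum>a<bundle_rank E.
      locality_at M E (metric_locality_operator E g) p (dual_coframe E X a p)
        (connection_at M E nab p (X a p) u) (v p) +
      locality_at M E (metric_locality_operator E g) p (dual_coframe E X a p)
        (connection_at M E nab p (X a p) v) (u p)"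
  have bracket: "br u v p + br v u p \<in> fibre E p"
    "y \<in> fibre E p \<Longrightarrow> g p (br u v p + br v u p) y = \<rho> p y (\<lambda>q. g q (u q) (v q))"
    if "u \<in> sections M E" "v \<in> sections M E" for u v p y
  proof -
    let ?D = "E_differential E \<rho> (\<lambda>q. g q (u q) (v q)) p"
    \<comment> \<open>The anchor is linear on the fibre, so \<open>?D\<close> is a covector and
      \<open>metric_inverse\<close> can be evaluated on it.\<close>
    have "linear_form_on (fibre E p) ?D"
      using \<rho> vector_bundle_subspace[OF E, of p]
      unfolding linear_form_on_def E_differential_def by (simp add: subspace_add subspace_scale)
    note inv = metric_inverse_props[OF g E this]
    have "br u v p + br v u p = metric_inverse E g p ?D"
      using courant that by (metis (no_types, lifting))
    with inv show "br u v p + br v u p \<in> fibre E p"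
      "y \<in> fibre E p \<Longrightarrow> g p (br u v p + br v u p) y = \<rho> p y (\<lambda>q. g q (u q) (v q))"
      by (auto simp: E_differential_def)
  qed
  have frame_sum: "?R X p u v \<in> fibre E p"
    "w \<in> sections M E \<Longrightarrow> g p (?R X p u v) (w p) = g p (nab w u p) (v p) + g p (u p) (nab w v p)"
    if X: "local_frame M E U X" "p \<in> U" and u: "u \<in> sections M E" and v: "v \<in> sections M E"
    for X U p u v w
  proof -
    note F = vector_bundle_subspace[OF E, of p]
    note uv = metric_locality_frame_sum[OF M E g nab X u sections_fibre[OF v]]
    note vu = metric_locality_frame_sum[OF M E g nab X v sections_fibre[OF u]]
    show mem: "?R X p u v \<in> fibre E p"
      unfolding sum.distrib using uv(1) vu(1) by (rule subspace_add[OF F])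
    assume w: "w \<in> sections M E"
    have wp: "w p \<in> fibre E p" and nv: "nab w v p \<in> fibre E p"
      using sections_fibre[OF w] connection_at_fibre[OF M E nab sections_fibre[OF w] v]
        connection_at_section[OF M E nab w v] by metis+
    \<comment> \<open>Additivity is available in the second slot, so the sum is moved there before
      it is split into its two halves.\<close>
    have "g p (?R X p u v) (w p) = g p (w p) (?R X p u v)"
      by (rule E_metricD(2)[OF g mem wp])
    also have "\<dots> = g p (nab w u p) (v p) + g p (nab w v p) (u p)"
      unfolding sum.distrib linear_form_on_add[OF E_metricD(1)[OF g wp] uv(1) vu(1)]
        E_metricD(2)[OF g wp uv(1)] E_metricD(2)[OF g wp vu(1)] uv(2)[OF wp] vu(2)[OF wp]
        connection_at_section[OF M E nab w u] connection_at_section[OF M E nab w v] ..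
    also have "g p (nab w v p) (u p) = g p (u p) (nab w v p)"
      by (rule E_metricD(2)[OF g nv sections_fibre[OF u]])
    finally show "g p (?R X p u v) (w p) = g p (nab w u p) (v p) + g p (u p) (nab w v p)" .
  qed
  show ?thesis
  proof
    assume adm: "admissible M E br (metric_locality_operator E g) nab"
    show "metric_compatible M E \<rho> g nab"
      unfolding metric_compatible_def
    proof (intro ballI allI)
      fix u v w p assume s: "u \<in> sections M E" "v \<in> sections M E" "w \<in> sections M E"
      \<comment> \<open>\<open>admissible\<close> speaks of frames, so it yields an equation at
        \<open>p\<close> only because some frame is defined around \<open>p\<close>.\<close>
      obtain U X where X: "local_frame M E U X" "p \<in> U"
        by (rule local_frame_exists[OF E])
      then have "br u v p + br v u p = ?R X p u v"
        using adm s(1,2) unfolding admissible_def by blast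
      then show "\<rho> p (w p) (\<lambda>q. g q (u q) (v q)) = g p (nab w u p) (v p) + g p (u p) (nab w v p)"
        using bracket(2)[OF s(1,2) sections_fibre[OF s(3)]] frame_sum(2)[OF X s] by metis
    qed
  next
    assume comp: "metric_compatible M E \<rho> g nab"
    show "admissible M E br (metric_locality_operator E g) nab"
      unfolding admissible_def
    proof (intro ballI allI impI)
      fix u v U X p assume s: "u \<in> sections M E" "v \<in> sections M E"
        and X: "local_frame M E U X" "p \<in> U"
      show "br u v p + br v u p = ?R X p u v"
      proof (rule E_metric_eqI[OF g E bracket(1)[OF s] frame_sum(1)[OF X s]])
        \<comment> \<open>Compatibility speaks of sections, so the test vector \<open>y\<close> is
          first extended to one.\<close>
        fix y assume "y \<in> fibre E p"
        then obtain w where w: "w \<in> sections M E" "w p = y"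
          by (rule section_through[OF M E])
        have "\<rho> p (w p) (\<lambda>q. g q (u q) (v q)) = g p (nab w u p) (v p) + g p (u p) (nab w v p)"
          using comp s w(1) unfolding metric_compatible_def by blast
        then show "g p (br u v p + br v u p) y = g p (?R X p u v) y"
          using bracket(2)[OF s sections_fibre[OF w(1)]] frame_sum(2)[OF X s w(1)] w(2) by metis
      qed
    qed
  qed
qed

end
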